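(* Let $n,d\in\mathbb{N}$, $\delta\in(0,1/4]$, let $\Sigma\in\mathbb{R}^{d\times d}$ be symmetric positive definite, $\Theta:=\mathbb{R}^d$ and $\mathcal{P}_\theta:=\{\mathsf{N}_d(\theta,\Sigma)^{\otimes n}\}$ for $\theta\in\Theta$. Then, for the loss $L(\theta,\theta')=\|\theta-\theta'\|_2^2$, $$\mathcal{M}(\delta,\mathcal{P}_\Theta,\|\cdot\|_2^2)\asymp\frac{\mathrm{tr}(\Sigma)}{n}+\frac{\|\Sigma\|_{\mathrm{op}}\log(1/\delta)}{n}.$$
   Context: For a pseudo-metric space $\Theta$ of parameters (with its Borel $\sigma$-algebra), a family $\mathcal{P}_\Theta=\{\mathcal{P}_\theta:\theta\in\Theta\}$ where each $\mathcal{P}_\theta$ is a set of probability measures on a measurable space $\mathcal{X}$, and a loss $L:\Theta\times\Theta\to[0,\infty)$, the minimax $(1-\delta)$th quantile is $$\mathcal{M}(\delta,\mathcal{P}_\Theta,L):=\inf_{\hat\theta}\sup_{\theta\in\Theta}\sup_{P_\theta\in\mathcal{P}_\theta}\inf\{r\in[0,\infty):P_\theta\{L(\hat\theta,\theta)\le r\}\ge1-\delta\},$$ where the first infimum is over all measurable functions $\hat\theta:\mathcal{X}\to\Theta$ (which may depend on $\delta$). Here $\mathcal{X}=(\mathbb{R}^d)^n$. The notation $\mathcal{M}(\delta,\mathcal{P}_\Theta,\|\cdot\|_2^2)$ refers to the loss $L(\theta,\theta')=\|\theta-\theta'\|_2^2$. $\|\cdot\|_{\mathrm{op}}$ is the operator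 (spectral) norm. $a\asymp b$ means that there are universal constants $c,C>0$ (not depending on any of the parameters, here $n,d,\delta,\Sigma$) with $cb\le a\le Cb$. *)

theory Defs
  imports
    "HOL-Probability.Probability"
    "Jordan_Normal_Form.Determinant"
    "Jordan_Normal_Form.Gauss_Jordan_Elimination"
begin

text \<open>
  The constants in the main statement must not depend on the dimension, so the dimension is a
  natural number and not a type: a point of \<open>\<real>\<^sup>d\<close> is a function in
  \<open>{..<d} \<rightarrow>\<^sub>E UNIV\<close>, and \<open>d \<times> d\<close> matrices are elements of
  \<open>carrier_mat d d\<close>.
\<close>

text \<open>
  \<open>X\<close> is the sample space (only its measurable structure is used) and \<open>T\<close> is the
  parameter set with its Borel \<open>\<sigma>\<close>-algebra. Values are in \<open>ennreal\<close>: the risk of an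
  estimator may be infinite, and the infimum of the empty set is \<open>\<infinity>\<close>.
\<close>

definition upper_quantile :: "real \<Rightarrow> 'x measure \<Rightarrow> ('x \<Rightarrow> real) \<Rightarrow> ennreal" where
  "upper_quantile \<delta> P f =
     Inf {ennreal r | r. 0 \<le> r \<and> measure P {x \<in> space P. f x \<le> r} \<ge> 1 - \<delta>}"

definition minimax_quantile ::
  "'x measure \<Rightarrow> 't measure \<Rightarrow> real \<Rightarrow> ('t \<Rightarrow> 'x measure set) \<Rightarrow> ('t \<Rightarrow> 't \<Rightarrow> real) \<Rightarrow> ennreal" where
  "minimax_quantile X T \<delta> \<P> L =
     (INF \<theta>' \<in> measurable X T. SUP \<theta> \<in> space T. SUP P \<in> \<P> \<theta>.
        upper_quantile \<delta> P (\<lambda>x. L (\<theta>' x) \<theta>))"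

text \<open>The Borel \<open>\<sigma>\<close>-algebra of \<open>\<real>\<^sup>d\<close> is the product of those of the factors.\<close>

definition euclidean_borel :: "nat \<Rightarrow> (nat \<Rightarrow> real) measure" where
  "euclidean_borel d = PiM {..<d} (\<lambda>_. borel)"

definition sq_loss :: "nat \<Rightarrow> (nat \<Rightarrow> real) \<Rightarrow> (nat \<Rightarrow> real) \<Rightarrow> real" where
  "sq_loss d \<theta> \<theta>' = (L2_set (\<lambda>i. \<theta> i - \<theta>' i) {..<d})\<^sup>2"

definition sym_pos_def :: "nat \<Rightarrow> real mat \<Rightarrow> bool" where
  "sym_pos_def d \<Sigma> \<longleftrightarrow> \<Sigma> \<in> carrier_mat d d \<and> transpose_mat \<Sigma> = \<Sigma> \<and>
     (\<forall>v \<in> carrier_vec d. v \<noteq> 0\<^sub>v d \<longrightarrow> scalar_prod v (mult_mat_vec \<Sigma> v) > 0)"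

definition mat_trace :: "real mat \<Rightarrow> real" where
  "mat_trace A = (\<Sum>i<dim_row A. A $$ (i, i))"

text \<open>
  The supremum is over the closed unit ball, which, unlike the unit sphere, is nonempty
  also in dimension \<open>0\<close>.
\<close>

definition op_norm :: "real mat \<Rightarrow> real" where
  "op_norm A =
     (SUP v \<in> {v \<in> carrier_vec (dim_col A). sqrt (scalar_prod v v) \<le> 1}.
        sqrt (scalar_prod (mult_mat_vec A v) (mult_mat_vec A v)))"

text \<open>
  The law \<open>N\<^sub>d(\<theta>, \<Sigma>)\<close> for nonsingular \<open>\<Sigma>\<close>, given by its density with respect to Lebesgue
  measure on \<open>\<real>\<^sup>d\<close>; then \<open>mat_inverse \<Sigma>\<close> is \<open>Some\<close> of the inverse of \<open>\<Sigma>\<close>.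
\<close>

definition mvn_density :: "nat \<Rightarrow> (nat \<Rightarrow> real) \<Rightarrow> real mat \<Rightarrow> (nat \<Rightarrow> real) \<Rightarrow> real" where
  "mvn_density d \<theta> \<Sigma> x =
     (let v = Matrix.vec d (\<lambda>i. x i - \<theta> i)
      in exp (- scalar_prod v (mult_mat_vec (the (mat_inverse \<Sigma>)) v) / 2)
           / sqrt ((2 * pi) ^ d * Determinant.det \<Sigma>))"

definition mvn :: "nat \<Rightarrow> (nat \<Rightarrow> real) \<Rightarrow> real mat \<Rightarrow> (nat \<Rightarrow> real) measure" where
  "mvn d \<theta> \<Sigma> = density (PiM {..<d} (\<lambda>_. lborel)) (\<lambda>x. ennreal (mvn_density d \<theta> \<Sigma> x))"

definition iid_sample :: "nat \<Rightarrow> 'a measure \<Rightarrow> (nat \<Rightarrow> 'a) measure" where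
  "iid_sample n P = PiM {..<n} (\<lambda>_. P)"

end

theory Submission
  imports Defs
begin

text \<open>
  Upper bound: let \<open>Z\<close> be the error of the sample mean, with covariance \<open>S = \<Sigma> / n\<close>.
  Averaging the moment generating function \<open>exp (\<langle>u, Z\<rangle> - u\<^sup>TSu / 2)\<close> over
  \<open>u \<sim> N(0, I / \<lambda>)\<close> with \<open>\<lambda> = \<parallel>S\<parallel>\<^sub>o\<^sub>p\<close>, recentring at
  \<open>u = Z / (2\<lambda>)\<close> and applying Jensen's inequality gives
  \<open>E exp (|Z|\<^sup>2 / (4\<lambda>)) \<le> exp (tr S / (2\<lambda>))\<close>, so no eigenvalues are needed;
  Markov's inequality does the rest.

  Lower bound: put the prior \<open>N(0, \<Sigma>)\<close> on \<open>\<theta>\<close>. By the parallelogram law for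
  \<open>\<Sigma>\<inverse>\<close>, the joint density \<open>g\<close> of parameter and sample satisfies
  \<open>g(\<theta> + h) g(\<theta> - h) = g(\<theta>)\<^sup>2 exp (- (n + 1) q)\<close> with \<open>q = h\<^sup>T \<Sigma>\<inverse> h\<close>.
  Hence an event \<open>E\<close> that is disjoint from both its translates by \<open>\<plusminus>h\<close>, themselves disjoint,
  has probability at most \<open>1 / (1 + 2 exp (- (n + 1) q / 2))\<close>. Taking for \<open>E\<close> the confidence
  event and \<open>h\<close> along a vector \<open>\<Sigma> v\<close> with \<open>|\<Sigma> v|\<close> nearly \<open>\<parallel>\<Sigma>\<parallel>\<^sub>o\<^sub>p\<close> gives the
  \<open>log (1/\<delta>)\<close> term. Taking for \<open>E\<close> the event of a small error in coordinate \<open>i\<close> and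
  \<open>h\<close> along \<open>\<Sigma> e\<^sub>i\<close>, and averaging over \<open>i\<close> with weights \<open>\<Sigma>\<^sub>i\<^sub>i\<close>, gives the trace term.
\<close>

subsection \<open>Gaussian integrals over quadratic forms\<close>

definition qform :: "nat \<Rightarrow> real mat \<Rightarrow> (nat \<Rightarrow> real) \<Rightarrow> real" where
  "qform d A x = (\<Sum>i<d. \<Sum>j<d. x i * A $$ (i, j) * x j)"

text \<open>This is the bridge from the vectors of the matrix library. Afterwards a point of R^d is
  a function of which only the values below \<open>d\<close> matter, so product measures and shifts
  apply to it directly.\<close>

lemma scalar_prod_mult_mat_vec:
  assumes "A \<in> carrier_mat d d"
  shows "scalar_prod (Matrix.vec d x) (mult_mat_vec A (Matrix.vec d x)) = qform d A x"
  using assms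
  by (auto simp: qform_def scalar_prod_def mult_mat_vec_def sum_distrib_left mult.assoc
           lessThan_atLeast0 intro!: sum.cong)

lemma qform_cong: "(\<And>i. i < d \<Longrightarrow> x i = y i) \<Longrightarrow> qform d A x = qform d A y"
  by (simp add: qform_def)

lemma sym_pos_def_carrier: "sym_pos_def d A \<Longrightarrow> A \<in> carrier_mat d d"
  by (simp add: sym_pos_def_def)

lemma sym_pos_def_sym:
  assumes "sym_pos_def d A" "i < d" "j < d"
  shows "A $$ (i, j) = A $$ (j, i)"
proof -
  have "transpose_mat A $$ (i, j) = A $$ (j, i)"
    using assms sym_pos_def_carrier[OF assms(1)] by (intro index_transpose_mat) auto
  then show ?thesis using assms(1) by (simp add: sym_pos_def_def)
qed

lemma sym_pos_def_qform_pos: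
  assumes "sym_pos_def d A" "i < d" "x i \<noteq> 0"
  shows "0 < qform d A x"
proof -
  have "Matrix.vec d x \<noteq> 0\<^sub>v d"
    using assms(2,3) by (metis index_vec index_zero_vec(1))
  then show ?thesis
    using assms(1) unfolding sym_pos_def_def
    by (metis scalar_prod_mult_mat_vec vec_carrier)
qed

lemma sym_pos_defI:
  assumes "A \<in> carrier_mat d d" "\<And>i j. i < d \<Longrightarrow> j < d \<Longrightarrow> A $$ (i, j) = A $$ (j, i)"
    and "\<And>x i. i < d \<Longrightarrow> x i \<noteq> 0 \<Longrightarrow> 0 < qform d A x"
  shows "sym_pos_def d A"
  unfolding sym_pos_def_def
proof (intro conjI ballI impI)
  show "A\<^sup>T = A"
    using assms(1,2) by (intro eq_matI) auto
  fix v :: "real vec" assume v: "v \<in> carrier_vec d" "v \<noteq> 0\<^sub>v d"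
  then obtain i where i: "i < d" "v $ i \<noteq> 0"
    by (metis carrier_vecD eq_vecI index_zero_vec(1) index_zero_vec(2))
  have "v = Matrix.vec d (vec_index v)" using v by auto
  then show "0 < scalar_prod v (mult_mat_vec A v)"
    using assms(3)[of i "vec_index v"] i scalar_prod_mult_mat_vec[OF assms(1), of "vec_index v"] by simp
qed (use assms in auto)

lemma sym_pos_def_diag_pos:
  assumes "sym_pos_def d A" "i < d"
  shows "0 < A $$ (i, i)"
proof -
  have "0 < qform d A (\<lambda>k. if k = i then 1 else 0)"
    using sym_pos_def_qform_pos[OF assms, of "\<lambda>k. if k = i then 1 else 0"] by simp
  also have "\<dots> = (\<Sum>k<d. if k = i then (\<Sum>l<d. if l = i then A $$ (k, l) else 0) else 0)"
    unfolding qform_def by (intro sum.cong refl) (simp add: mult_delta_left mult_delta_right)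
  also have "\<dots> = A $$ (i, i)"
    using assms(2) by simp
  finally show ?thesis .
qed

section \<open>Eliminating the last coordinate\<close>

definition schur_complement :: "nat \<Rightarrow> real mat \<Rightarrow> real mat" where
  "schur_complement d A = mat d d (\<lambda>(i, j). A $$ (i, j) - A $$ (i, d) * A $$ (j, d) / A $$ (d, d))"

text \<open>The terms with index \<open>d\<close> are a x_d^2 + 2 x_d s, where a is the pivot and s
  the off-diagonal sum. Completing the square leaves - s^2 / a, a rank one correction that the Schur
  complement absorbs.\<close>

lemma qform_Suc_complete_square:
  assumes "sym_pos_def (Suc d) A"
  shows "qform (Suc d) A x = A $$ (d, d) * (x d + (\<Sum>j<d. A $$ (j, d) * x j) / A $$ (d, d))\<^sup>2
           + qform d (schur_complement d A) x"
proof -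
  define a where "a = A $$ (d, d)"
  define s where "s = (\<Sum>j<d. A $$ (j, d) * x j)"
  have a: "a \<noteq> 0" using sym_pos_def_diag_pos[OF assms, of d] by (simp add: a_def)
  have s': "(\<Sum>j<d. x d * A $$ (d, j) * x j) = x d * s"
    unfolding s_def sum_distrib_left
    by (intro sum.cong) (auto simp: sym_pos_def_sym[OF assms, of d])
  have s'': "(\<Sum>i<d. x i * A $$ (i, d) * x d) = x d * s"
    unfolding s_def sum_distrib_left by (intro sum.cong) auto
  have ss: "s * s / a = (\<Sum>i<d. \<Sum>j<d. x i * (A $$ (i, d) * A $$ (j, d) / a) * x j)"
    unfolding s_def sum_product sum_divide_distrib by (intro sum.cong refl) (simp add: field_simps)
  have "qform d (schur_complement d A) x = (\<Sum>i<d. \<Sum>j<d. x i * A $$ (i, j) * x j) - s * s / a"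
    unfolding ss
    by (simp add: qform_def schur_complement_def sum_subtractf[symmetric] algebra_simps a_def)
  moreover have "qform (Suc d) A x
      = (\<Sum>i<d. \<Sum>j<d. x i * A $$ (i, j) * x j) + x d * s + (x d * s + x d * a * x d)"
    by (simp add: qform_def sum.distrib s' s'' a_def)
  moreover have "a * (x d + s / a)\<^sup>2 = a * x d * x d + 2 * x d * s + s * s / a"
    using a by (simp add: power2_eq_square field_simps)
  ultimately show ?thesis
    unfolding a_def[symmetric] s_def[symmetric] by (simp add: algebra_simps)
qed

lemma sym_pos_def_schur_complement:
  assumes "sym_pos_def (Suc d) A"
  shows "sym_pos_def d (schur_complement d A)"
proof (rule sym_pos_defI)
  show "schur_complement d A \<in> carrier_mat d d" by (simp add: schur_complement_def)
  show "schur_complement d A $$ (i, j) = schur_complement d A $$ (j, i)" if "i < d" "j < d" for i j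
    using that sym_pos_def_sym[OF assms, of i j] by (simp add: schur_complement_def)
  fix x :: "nat \<Rightarrow> real" and i assume i: "i < d" "x i \<noteq> 0"
  \<comment> \<open>With this last coordinate the completed square vanishes, so positivity of the
    large form becomes positivity of the Schur complement.\<close>
  define y where "y = x(d := - (\<Sum>j<d. A $$ (j, d) * x j) / A $$ (d, d))"
  have s: "(\<Sum>j<d. A $$ (j, d) * y j) = (\<Sum>j<d. A $$ (j, d) * x j)"
    by (simp add: y_def)
  have "0 < qform (Suc d) A y"
    using sym_pos_def_qform_pos[OF assms, of i y] i by (simp add: y_def)
  also have "\<dots> = qform d (schur_complement d A) y"
    unfolding qform_Suc_complete_square[OF assms] s by (simp add: y_def)
  also have "\<dots> = qform d (schur_complement d A) x"
    by (rule qform_cong) (simp add: y_def)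
  finally show "0 < qform d (schur_complement d A) x" .
qed

text \<open>One step of Gaussian elimination: right multiplication by the unit lower triangular
  \<open>L\<close> subtracts multiples of the last column and clears the last row to the left of the
  pivot. The product \<open>U\<close> is block triangular, which yields its determinant.\<close>

lemma det_schur_complement:
  assumes "sym_pos_def (Suc d) A"
  shows "Determinant.det A = A $$ (d, d) * Determinant.det (schur_complement d A)"
proof -
  define a where "a = A $$ (d, d)"
  have a: "a \<noteq> 0" using sym_pos_def_diag_pos[OF assms, of d] by (simp add: a_def)
  have A: "A \<in> carrier_mat (Suc d) (Suc d)" using assms by (rule sym_pos_def_carrier)
  define L where "L = four_block_mat (1\<^sub>m d) (0\<^sub>m d 1) (mat 1 d (\<lambda>(i, j). - A $$ (d, j) / a)) (1\<^sub>m 1)"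
  define U where "U = four_block_mat (schur_complement d A) (mat d 1 (\<lambda>(i, j). A $$ (i, d)))
                        (0\<^sub>m 1 d) (mat 1 1 (\<lambda>_. a))"
  have S: "schur_complement d A \<in> carrier_mat d d" by (simp add: schur_complement_def)
  have Lc: "L \<in> carrier_mat (Suc d) (Suc d)" 
    using four_block_carrier_mat[of "1\<^sub>m d" d d "1\<^sub>m 1" 1 1] by (simp add: L_def)
  have Uc: "U \<in> carrier_mat (Suc d) (Suc d)" 
    using four_block_carrier_mat[OF S, of "mat 1 1 (\<lambda>_. a)" 1 1] by (simp add: U_def)
  have "A * L = U"
  proof (rule eq_matI)
    fix i j assume "i < dim_row U" "j < dim_col U"
    then have ij: "i < Suc d" "j < Suc d" using Uc by auto
    have "(A * L) $$ (i, j) = (\<Sum>k<Suc d. A $$ (i, k) * L $$ (k, j))"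
      using ij A Lc unfolding lessThan_atLeast0
      by (auto simp: times_mat_def scalar_prod_def simp del: sum.op_ivl_Suc intro!: sum.cong)
    also have "\<dots> = U $$ (i, j)"
    proof (cases "j < d")
      case True
      have "(\<Sum>k<Suc d. A $$ (i, k) * L $$ (k, j)) = (\<Sum>k<d. A $$ (i, k) * (if k = j then 1 else 0)) - A $$ (i, d) * A $$ (d, j) / a"
        using True by (simp add: L_def)
      also have "\<dots> = A $$ (i, j) - A $$ (i, d) * A $$ (d, j) / a"
        using True by (simp add: if_distrib cong: if_cong)
      also have "\<dots> = U $$ (i, j)"
        using True ij a S sym_pos_def_sym[OF assms, of d j]
        by (cases "i = d") (auto simp: U_def schur_complement_def a_def)
      finally show ?thesis .
    next
      case False
      then have j: "j = d" using ij by simp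
      have "(\<Sum>k<Suc d. A $$ (i, k) * L $$ (k, j)) = A $$ (i, d)"
        using j by (simp add: L_def)
      also have "\<dots> = U $$ (i, j)"
        using j ij S by (cases "i = d") (auto simp: U_def a_def)
      finally show ?thesis .
    qed
    finally show "(A * L) $$ (i, j) = U $$ (i, j)" .
  qed (use A Lc Uc in auto)
  then have "Determinant.det A * Determinant.det L = Determinant.det U"
    using det_mult[OF A Lc] by simp
  moreover have "Determinant.det L = 1"
    unfolding L_def by (subst det_four_block_mat_upper_right_zero[of _ d _ 1]) auto
  moreover have "Determinant.det U = Determinant.det (schur_complement d A) * a"
    unfolding U_def
    by (subst det_four_block_mat_lower_left_zero[of _ d _ 1]) (auto simp: S det_single)
  ultimately show ?thesis by (simp add: a_def)
qed

section \<open>The Gaussian integral in every dimension\<close>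

lemma nn_integral_gaussian_real:
  fixes a c :: real
  assumes "0 < a"
  shows "(\<integral>\<^sup>+ y. ennreal (exp (- (a * (y + c)\<^sup>2 / 2))) \<partial>lborel) = ennreal (sqrt (2 * pi / a))"
proof -
  interpret prob_space "density lborel (normal_density (- c) (1 / sqrt a))"
    using assms by (intro prob_space_normal_density) simp
  have "exp (- (a * (y + c)\<^sup>2 / 2)) = sqrt (2 * pi / a) * normal_density (- c) (1 / sqrt a) y" for y
    using assms by (simp add: normal_density_def power_divide real_sqrt_divide field_simps)
  then have "(\<integral>\<^sup>+ y. ennreal (exp (- (a * (y + c)\<^sup>2 / 2))) \<partial>lborel)
      = ennreal (sqrt (2 * pi / a)) * (\<integral>\<^sup>+ y. ennreal (normal_density (- c) (1 / sqrt a) y) \<partial>lborel)"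
    using assms by (simp add: ennreal_mult nn_integral_cmult)
  also have "(\<integral>\<^sup>+ y. ennreal (normal_density (- c) (1 / sqrt a) y) \<partial>lborel) = 1"
    using emeasure_space_1 by (simp add: emeasure_density)
  finally show ?thesis by simp
qed

lemma measurable_qform:
  assumes "\<And>i. i < d \<Longrightarrow> (\<lambda>x. f x i) \<in> borel_measurable M"
  shows "(\<lambda>x. qform d A (f x)) \<in> borel_measurable M"
  unfolding qform_def using assms
  by (intro borel_measurable_sum borel_measurable_times borel_measurable_const) auto

lemma measurable_component_lborel:
  fixes I :: "'i set"
  assumes "i \<in> I"
  shows "(\<lambda>x. x i) \<in> borel_measurable (PiM I (\<lambda>_. lborel :: real measure))"
  using measurable_component_singleton[OF assms, of "\<lambda>_. lborel :: real measure"] by simp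

text \<open>Induction on the dimension, integrating out the last coordinate. Positivity of the
  determinant is carried along because the constant divides by it; later it yields invertibility of
  the covariance.\<close>

theorem nn_integral_gaussian_qform:
  assumes "sym_pos_def d A"
  shows "0 < Determinant.det A \<and>
    (\<integral>\<^sup>+ x. ennreal (exp (- qform d A x / 2)) \<partial>PiM {..<d} (\<lambda>_. lborel))
      = ennreal (sqrt ((2 * pi) ^ d / Determinant.det A))"
  using assms
proof (induction d arbitrary: A)
  case 0
  interpret product_sigma_finite "\<lambda>_::nat. lborel :: real measure" by standard
  have "Determinant.det A = 1" using 0 by (intro det_dim_zero sym_pos_def_carrier)
  then show ?case by (simp add: nn_integral_empty qform_def space_PiM)
next
  case (Suc d)
  interpret product_sigma_finite "\<lambda>_::nat. lborel :: real measure" by standard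
  let ?S = "schur_complement d A" and ?a = "A $$ (d, d)"
  have a: "0 < ?a" using sym_pos_def_diag_pos[OF Suc.prems, of d] by simp
  have [measurable]: "(\<lambda>x. qform (Suc d) A x) \<in> borel_measurable (PiM (insert d {..<d}) (\<lambda>_. lborel))"
    by (intro measurable_qform measurable_component_lborel) auto
  have [measurable]: "(\<lambda>x. qform d ?S x) \<in> borel_measurable (PiM {..<d} (\<lambda>_. lborel))"
    by (intro measurable_qform measurable_component_lborel) auto
  have IH: "0 < Determinant.det ?S"
    "(\<integral>\<^sup>+ x. ennreal (exp (- qform d ?S x / 2)) \<partial>PiM {..<d} (\<lambda>_. lborel))
      = ennreal (sqrt ((2 * pi) ^ d / Determinant.det ?S))"
    using Suc.IH[OF sym_pos_def_schur_complement[OF Suc.prems]] by auto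
  \<comment> \<open>The centre of the square depends on \<open>x\<close>, but a one-dimensional
    Gaussian integral does not depend on its centre, so integrating over \<open>y\<close> only
    contributes a constant factor.\<close>
  have split: "exp (- qform (Suc d) A (x(d := y)) / 2)
      = exp (- (?a * (y + (\<Sum>j<d. A $$ (j, d) * x j) / ?a)\<^sup>2) / 2) * exp (- qform d ?S x / 2)" for x y
  proof -
    have "qform d ?S (x(d := y)) = qform d ?S x" by (rule qform_cong) auto
    then show ?thesis
      by (simp add: qform_Suc_complete_square[OF Suc.prems] exp_add[symmetric] add_divide_distrib)
  qed
  have "(\<integral>\<^sup>+ x. ennreal (exp (- qform (Suc d) A x / 2)) \<partial>PiM {..<Suc d} (\<lambda>_. lborel))
      = (\<integral>\<^sup>+ x. (\<integral>\<^sup>+ y. ennreal (exp (- qform (Suc d) A (x(d := y)) / 2)) \<partial>lborel) \<partial>PiM {..<d} (\<lambda>_. lborel))"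
    unfolding lessThan_Suc 
    by (rule product_nn_integral_insert) auto
  also have "\<dots> = (\<integral>\<^sup>+ x. ennreal (sqrt (2 * pi / ?a)) * ennreal (exp (- qform d ?S x / 2)) \<partial>PiM {..<d} (\<lambda>_. lborel))"
    unfolding split by (simp add: ennreal_mult nn_integral_multc nn_integral_gaussian_real[OF a])
  also have "\<dots> = ennreal (sqrt (2 * pi / ?a)) * ennreal (sqrt ((2 * pi) ^ d / Determinant.det ?S))"
    unfolding IH(2)[symmetric] by (rule nn_integral_cmult) measurable
  also have "\<dots> = ennreal (sqrt ((2 * pi) ^ Suc d / Determinant.det A))"
    using a IH(1)
    by (simp add: ennreal_mult[symmetric] real_sqrt_mult[symmetric] det_schur_complement[OF Suc.prems] field_simps)
  finally show ?case
    using a IH(1) by (simp add: det_schur_complement[OF Suc.prems])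
qed

subsection \<open>The multivariate normal law\<close>

lemma (in product_sigma_finite) PiM_density:
  assumes "finite I" and [measurable]: "\<And>i. f i \<in> borel_measurable (M i)"
    and "\<And>i. prob_space (density (M i) (f i))"
  shows "PiM I (\<lambda>i. density (M i) (f i)) = density (PiM I M) (\<lambda>x. \<Prod>i\<in>I. f i (x i))"
proof -
  interpret D: product_sigma_finite "\<lambda>i. density (M i) (f i)"
    using assms(3) by (simp add: product_sigma_finite_def prob_space_imp_sigma_finite)
  have [measurable]: "(\<lambda>x. \<Prod>i\<in>I. f i (x i)) \<in> borel_measurable (PiM I M)"
    by measurable
  show ?thesis
  proof (rule D.PiM_eqI[OF assms(1), symmetric])
    show "sets (density (PiM I M) (\<lambda>x. \<Prod>i\<in>I. f i (x i))) = sets (PiM I (\<lambda>i. density (M i) (f i)))"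
      by (simp cong: sets_PiM_cong)
    fix A assume "\<And>i. i \<in> I \<Longrightarrow> A i \<in> sets (density (M i) (f i))"
    then have A[measurable]: "\<And>i. i \<in> I \<Longrightarrow> A i \<in> sets (M i)" by simp
    have "emeasure (density (PiM I M) (\<lambda>x. \<Prod>i\<in>I. f i (x i))) (Pi\<^sub>E I A)
        = (\<integral>\<^sup>+ x. (\<Prod>i\<in>I. f i (x i)) * indicator (Pi\<^sub>E I A) x \<partial>PiM I M)"
      using assms(1) A by (intro emeasure_density) auto
    \<comment> \<open>The indicator of a box is the product of the indicators of its sides, so the
      integral factorises.\<close>
    also have "\<dots> = (\<integral>\<^sup>+ x. (\<Prod>i\<in>I. f i (x i) * indicator (A i) (x i)) \<partial>PiM I M)"
    proof (rule nn_integral_cong)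
      fix x assume x: "x \<in> space (PiM I M)"
      have "indicator (Pi\<^sub>E I A) x = (\<Prod>i\<in>I. indicator (A i) (x i) :: ennreal)"
      proof (cases "x \<in> Pi\<^sub>E I A")
        case True
        then show ?thesis by (auto simp: PiE_mem)
      next
        case False
        then obtain i where "i \<in> I" "x i \<notin> A i" using x by (auto simp: space_PiM PiE_iff)
        then show ?thesis using False assms(1) by (auto intro!: prod_zero[symmetric] bexI[of _ i])
      qed
      then show "(\<Prod>i\<in>I. f i (x i)) * indicator (Pi\<^sub>E I A) x = (\<Prod>i\<in>I. f i (x i) * indicator (A i) (x i))"
        by (simp add: prod.distrib)
    qed
    also have "\<dots> = (\<Prod>i\<in>I. \<integral>\<^sup>+ y. f i y * indicator (A i) y \<partial>M i)"
      using assms(1) by (intro product_nn_integral_prod) auto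
    also have "\<dots> = (\<Prod>i\<in>I. emeasure (density (M i) (f i)) (A i))"
      using A by (intro prod.cong refl) (simp add: emeasure_density)
    finally show "emeasure (density (PiM I M) (\<lambda>x. \<Prod>i\<in>I. f i (x i))) (Pi\<^sub>E I A)
        = (\<Prod>i\<in>I. emeasure (density (M i) (f i)) (A i))" .
  qed
qed

section \<open>Translation invariance on R^d\<close>

abbreviation lborel_PiM :: "nat \<Rightarrow> (nat \<Rightarrow> real) measure" where
  "lborel_PiM d \<equiv> PiM {..<d} (\<lambda>_. lborel)"

text \<open>The restriction makes the result extensional, so that translating stays inside the space
  of the product measure.\<close>

definition translate :: "nat \<Rightarrow> (nat \<Rightarrow> real) \<Rightarrow> (nat \<Rightarrow> real) \<Rightarrow> nat \<Rightarrow> real" where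
  "translate d h x = (\<lambda>i\<in>{..<d}. x i + h i)"

lemma translate_apply [simp]: "i < d \<Longrightarrow> translate d h x i = x i + h i"
  by (simp add: translate_def)

lemma translate_translate: "translate d h (translate d k x) = translate d (\<lambda>i. k i + h i) x"
  by (auto simp: translate_def)

lemma translate_0: "x \<in> extensional {..<d} \<Longrightarrow> translate d (\<lambda>_. 0) x = x"
  by (auto simp: translate_def extensional_def)

lemma measurable_translate [measurable]: "translate d h \<in> measurable (lborel_PiM d) (lborel_PiM d)"
  unfolding translate_def
  by (rule measurable_restrict) (auto intro!: borel_measurable_add measurable_component_lborel)

text \<open>Boxes determine the product measure, and the preimage of a box is again a box, with
  shifted sides of unchanged measure.\<close>

lemma distr_translate: "distr (lborel_PiM d) (lborel_PiM d) (translate d h) = lborel_PiM d"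
proof -
  interpret product_sigma_finite "\<lambda>_::nat. lborel :: real measure" by standard
  show ?thesis
  proof (rule PiM_eqI)
    fix A :: "nat \<Rightarrow> real set" assume A: "\<And>i. i \<in> {..<d} \<Longrightarrow> A i \<in> sets lborel"
    have vimage: "translate d h -` (Pi\<^sub>E {..<d} A) \<inter> space (lborel_PiM d)
        = Pi\<^sub>E {..<d} (\<lambda>i. (\<lambda>y. y + h i) -` A i)"
      by (auto simp: space_PiM PiE_iff translate_def)
    have "emeasure (distr (lborel_PiM d) (lborel_PiM d) (translate d h)) (Pi\<^sub>E {..<d} A)
        = (\<Prod>i<d. emeasure lborel ((\<lambda>y. y + h i) -` A i))"
      using A by (subst emeasure_distr)
        (auto simp: vimage intro!: emeasure_PiM measurable_sets_borel[of "\<lambda>y. y + h _" borel] sets_PiM_I_finite)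
    also have "\<dots> = (\<Prod>i<d. emeasure lborel (A i))"
    proof (rule prod.cong)
      fix i assume "i \<in> {..<d}"
      then have "emeasure (distr lborel borel (\<lambda>y. h i + y)) (A i) = emeasure lborel ((\<lambda>y. y + h i) -` A i)"
        using A by (subst emeasure_distr) (auto simp: add.commute[of _ "h i"])
      then show "emeasure lborel ((\<lambda>y. y + h i) -` A i) = emeasure lborel (A i)"
        by (simp add: lborel_distr_plus)
    qed simp
    finally show "emeasure (distr (lborel_PiM d) (lborel_PiM d) (translate d h)) (Pi\<^sub>E {..<d} A)
        = (\<Prod>i\<in>{..<d}. emeasure lborel (A i))" .
  qed auto
qed

lemma nn_integral_translate:
  assumes [measurable]: "f \<in> borel_measurable (lborel_PiM d)"
  shows "(\<integral>\<^sup>+ x. f (translate d h x) \<partial>lborel_PiM d) = (\<integral>\<^sup>+ x. f x \<partial>lborel_PiM d)"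
proof -
  have "(\<integral>\<^sup>+ x. f x \<partial>lborel_PiM d) = (\<integral>\<^sup>+ x. f x \<partial>distr (lborel_PiM d) (lborel_PiM d) (translate d h))"
    by (simp add: distr_translate)
  also have "\<dots> = (\<integral>\<^sup>+ x. f (translate d h x) \<partial>lborel_PiM d)"
    by (rule nn_integral_distr) measurable
  finally show ?thesis by simp
qed

section \<open>Matrix-vector algebra and the inverse covariance\<close>

definition mat_apply :: "nat \<Rightarrow> real mat \<Rightarrow> (nat \<Rightarrow> real) \<Rightarrow> nat \<Rightarrow> real" where
  "mat_apply d A x i = (\<Sum>j<d. A $$ (i, j) * x j)"

lemma qform_eq_sum: "qform d A x = (\<Sum>i<d. x i * mat_apply d A x i)"
  by (simp add: qform_def mat_apply_def sum_distrib_left mult.assoc)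

lemma mat_apply_cong: "(\<And>i. i < d \<Longrightarrow> x i = y i) \<Longrightarrow> mat_apply d A x = mat_apply d A y"
  by (simp add: mat_apply_def fun_eq_iff)

lemma mat_apply_add: "mat_apply d A (\<lambda>i. x i + y i) i = mat_apply d A x i + mat_apply d A y i"
  by (simp add: mat_apply_def algebra_simps sum.distrib)

lemma mat_apply_scale: "mat_apply d A (\<lambda>i. c * x i) i = c * mat_apply d A x i"
  by (simp add: mat_apply_def algebra_simps sum_distrib_left)

lemma mat_apply_mult:
  assumes "A \<in> carrier_mat d d" "B \<in> carrier_mat d d" "i < d"
  shows "mat_apply d A (mat_apply d B x) i = mat_apply d (A * B) x i"
proof -
  have "mat_apply d (A * B) x i = (\<Sum>j<d. \<Sum>k<d. A $$ (i, k) * B $$ (k, j) * x j)"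
    unfolding mat_apply_def using assms
    by (intro sum.cong refl) (auto simp: scalar_prod_def lessThan_atLeast0 sum_distrib_right)
  also have "\<dots> = (\<Sum>k<d. \<Sum>j<d. A $$ (i, k) * B $$ (k, j) * x j)"
    by (rule sum.swap)
  finally show ?thesis by (simp add: mat_apply_def sum_distrib_left mult.assoc)
qed

lemma mat_apply_one: "i < d \<Longrightarrow> mat_apply d (1\<^sub>m d) x i = x i"
  by (simp add: mat_apply_def mult_delta_left)

lemma sum_mat_apply_commute:
  assumes "sym_pos_def d A"
  shows "(\<Sum>i<d. x i * mat_apply d A y i) = (\<Sum>i<d. y i * mat_apply d A x i)"
proof -
  have "(\<Sum>i<d. x i * mat_apply d A y i) = (\<Sum>i<d. \<Sum>j<d. y j * (A $$ (j, i) * x i))"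
    unfolding mat_apply_def sum_distrib_left
    by (intro sum.cong refl) (use sym_pos_def_sym[OF assms] in auto)
  also have "\<dots> = (\<Sum>j<d. \<Sum>i<d. y j * (A $$ (j, i) * x i))"
    by (rule sum.swap)
  finally show ?thesis by (simp add: mat_apply_def sum_distrib_left)
qed

lemma qform_add:
  assumes "sym_pos_def d A"
  shows "qform d A (\<lambda>i. x i + y i) = qform d A x + 2 * (\<Sum>i<d. x i * mat_apply d A y i) + qform d A y"
  using sum_mat_apply_commute[OF assms, of x y]
  by (simp add: qform_eq_sum mat_apply_add algebra_simps sum.distrib)

lemma qform_scale: "qform d A (\<lambda>i. c * x i) = c\<^sup>2 * qform d A x"
  by (simp add: qform_eq_sum mat_apply_scale sum_distrib_left power2_eq_square algebra_simps)

lemma qform_diff: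
  assumes "sym_pos_def d A"
  shows "qform d A (\<lambda>i. x i - y i) = qform d A x - 2 * (\<Sum>i<d. x i * mat_apply d A y i) + qform d A y"
  using qform_add[OF assms, of x "\<lambda>i. - 1 * y i"]
  unfolding mat_apply_scale qform_scale by (simp add: sum_negf)

abbreviation inv_mat :: "real mat \<Rightarrow> real mat" where
  "inv_mat \<Sigma> \<equiv> the (mat_inverse \<Sigma>)"

text \<open>The Gaussian integral has shown the determinant to be positive, so
  \<open>mat_inverse\<close> returns \<open>Some\<close> matrix and \<open>the\<close> extracts a
  genuine inverse.\<close>

lemma sym_pos_def_inverse:
  assumes "sym_pos_def d \<Sigma>"
  shows "inv_mat \<Sigma> \<in> carrier_mat d d" "\<Sigma> * inv_mat \<Sigma> = 1\<^sub>m d" "inv_mat \<Sigma> * \<Sigma> = 1\<^sub>m d"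
proof -
  have "\<Sigma> \<in> carrier_mat d d" using assms by (rule sym_pos_def_carrier)
  moreover have "Determinant.det \<Sigma> \<noteq> 0"
    using nn_integral_gaussian_qform[OF assms] by simp
  ultimately have "mat_inverse \<Sigma> \<noteq> None"
    using mat_inverse(1)[of \<Sigma> d "()"] det_non_zero_imp_unit[of \<Sigma> d "()"] by blast
  then obtain B where B: "mat_inverse \<Sigma> = Some B" by blast
  with mat_inverse(2)[OF \<open>\<Sigma> \<in> carrier_mat d d\<close> B]
  show "inv_mat \<Sigma> \<in> carrier_mat d d" "\<Sigma> * inv_mat \<Sigma> = 1\<^sub>m d" "inv_mat \<Sigma> * \<Sigma> = 1\<^sub>m d"
    by auto
qed

lemma mat_apply_inverse:
  assumes "sym_pos_def d \<Sigma>" "i < d"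
  shows "mat_apply d (inv_mat \<Sigma>) (mat_apply d \<Sigma> x) i = x i"
    "mat_apply d \<Sigma> (mat_apply d (inv_mat \<Sigma>) x) i = x i"
  using assms sym_pos_def_inverse[OF assms(1)] sym_pos_def_carrier[OF assms(1)]
  by (simp_all add: mat_apply_mult mat_apply_one)

text \<open>Measured by the inverse form, a shift \<Sigma> u has size u^T \<Sigma> u; both lower
  bounds choose their shifts in this form.\<close>

lemma qform_inverse:
  assumes "sym_pos_def d \<Sigma>"
  shows "qform d (inv_mat \<Sigma>) (mat_apply d \<Sigma> x) = qform d \<Sigma> x"
    "qform d \<Sigma> (mat_apply d (inv_mat \<Sigma>) x) = qform d (inv_mat \<Sigma>) x"
  by (simp_all add: qform_eq_sum mat_apply_inverse[OF assms] mult.commute)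

lemma sym_pos_def_inv_mat:
  assumes "sym_pos_def d \<Sigma>"
  shows "sym_pos_def d (inv_mat \<Sigma>)"
proof (rule sym_pos_defI)
  note inv = sym_pos_def_inverse[OF assms] and \<Sigma> = sym_pos_def_carrier[OF assms]
  show "inv_mat \<Sigma> \<in> carrier_mat d d" by fact
  \<comment> \<open>The transpose of the inverse is also a left inverse of the symmetric \<Sigma>,
    hence equal to the inverse.\<close>
  define T where "T = transpose_mat (inv_mat \<Sigma>)"
  have T: "T \<in> carrier_mat d d" using inv(1) by (simp add: T_def)
  have "transpose_mat (\<Sigma> * inv_mat \<Sigma>) = T * transpose_mat \<Sigma>"
    unfolding T_def using \<Sigma> inv(1) by (rule transpose_mult)
  then have "T * \<Sigma> = 1\<^sub>m d" using assms by (simp add: inv(2) sym_pos_def_def)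
  moreover have "(T * \<Sigma>) * inv_mat \<Sigma> = T * (\<Sigma> * inv_mat \<Sigma>)"
    using T \<Sigma> inv(1) by (rule assoc_mult_mat)
  ultimately have "inv_mat \<Sigma> = T"
    using T inv by simp
  then have "transpose_mat (inv_mat \<Sigma>) = inv_mat \<Sigma>" by (simp add: T_def)
  then show "inv_mat \<Sigma> $$ (i, j) = inv_mat \<Sigma> $$ (j, i)" if "i < d" "j < d" for i j
    using that inv(1) by (metis carrier_matD(1) carrier_matD(2) index_transpose_mat(1))
  fix x :: "nat \<Rightarrow> real" and i assume i: "i < d" "x i \<noteq> 0"
  \<comment> \<open>If \<Sigma>^-1 x vanished, so would x = \<Sigma> \<Sigma>^-1 x. Positivity then
    comes from the form of \<Sigma> at the vector \<Sigma>^-1 x.\<close>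
  have "\<exists>k<d. mat_apply d (inv_mat \<Sigma>) x k \<noteq> 0"
  proof (rule ccontr)
    assume "\<not> ?thesis"
    then have "mat_apply d \<Sigma> (mat_apply d (inv_mat \<Sigma>) x) i = mat_apply d \<Sigma> (\<lambda>_. 0) i"
      by (intro fun_cong[OF mat_apply_cong]) auto
    then show False using i by (simp add: mat_apply_inverse[OF assms]) (simp add: mat_apply_def)
  qed
  then show "0 < qform d (inv_mat \<Sigma>) x"
    using sym_pos_def_qform_pos[OF assms] by (metis qform_inverse(2)[OF assms])
qed

lemma det_inv_mat:
  assumes "sym_pos_def d \<Sigma>"
  shows "Determinant.det (inv_mat \<Sigma>) = 1 / Determinant.det \<Sigma>"
proof -
  have "Determinant.det \<Sigma> * Determinant.det (inv_mat \<Sigma>) = 1"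
    using det_mult[OF sym_pos_def_carrier[OF assms] sym_pos_def_inverse(1)[OF assms]]
    by (simp add: sym_pos_def_inverse(2)[OF assms])
  then show ?thesis by (metis mult_eq_0_iff nonzero_eq_divide_eq zero_neq_one mult.commute)
qed

section \<open>Density and exponential moments of the normal law\<close>

lemma mvn_density_eq:
  assumes "sym_pos_def d \<Sigma>"
  shows "mvn_density d \<theta> \<Sigma> x
    = exp (- qform d (inv_mat \<Sigma>) (\<lambda>i. x i - \<theta> i) / 2) / sqrt ((2 * pi) ^ d * Determinant.det \<Sigma>)"
  using scalar_prod_mult_mat_vec[OF sym_pos_def_inverse(1)[OF assms], of "\<lambda>i. x i - \<theta> i"]
  by (simp add: mvn_density_def)

lemma mvn_density_nonneg:
  assumes "sym_pos_def d \<Sigma>"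
  shows "0 \<le> mvn_density d \<theta> \<Sigma> x"
  using nn_integral_gaussian_qform[OF assms] by (simp add: mvn_density_eq[OF assms])

text \<open>Measurability is stated jointly in the mean and the point, since the prior makes the
  mean random.\<close>

lemma measurable_mvn_density:
  assumes "sym_pos_def d \<Sigma>"
    and [measurable]: "\<And>i. i < d \<Longrightarrow> (\<lambda>z. f z i) \<in> borel_measurable M"
      "\<And>i. i < d \<Longrightarrow> (\<lambda>z. g z i) \<in> borel_measurable M"
  shows "(\<lambda>z. mvn_density d (f z) \<Sigma> (g z)) \<in> borel_measurable M"
proof -
  have [measurable]: "(\<lambda>z. qform d (inv_mat \<Sigma>) (\<lambda>i. g z i - f z i)) \<in> borel_measurable M"
    by (intro measurable_qform) measurable
  show ?thesis unfolding mvn_density_eq[OF assms(1)] by measurable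
qed

lemma measurable_mvn_density' [measurable]:
  assumes "sym_pos_def d \<Sigma>"
  shows "mvn_density d \<theta> \<Sigma> \<in> borel_measurable (lborel_PiM d)"
  using measurable_mvn_density[OF assms, of "\<lambda>_. \<theta>" "lborel_PiM d" "\<lambda>x. x"]
  by (simp add: measurable_component_lborel)

lemma nn_integral_mvn_density:
  assumes "sym_pos_def d \<Sigma>"
  shows "(\<integral>\<^sup>+ x. ennreal (mvn_density d \<theta> \<Sigma> x) \<partial>lborel_PiM d) = 1"
proof -
  note [measurable] = measurable_mvn_density'[OF assms]
  let ?c = "sqrt ((2 * pi) ^ d * Determinant.det \<Sigma>)"
  note det = conjunct1[OF nn_integral_gaussian_qform[OF assms]]
  have [measurable]: "(\<lambda>x. qform d (inv_mat \<Sigma>) x) \<in> borel_measurable (lborel_PiM d)"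
    by (intro measurable_qform measurable_component_lborel) auto
  have "mvn_density d \<theta> \<Sigma> (translate d \<theta> x) = (1 / ?c) * exp (- qform d (inv_mat \<Sigma>) x / 2)" for x
  proof -
    have "qform d (inv_mat \<Sigma>) (\<lambda>i. translate d \<theta> x i - \<theta> i) = qform d (inv_mat \<Sigma>) x"
      by (rule qform_cong) simp
    then show ?thesis by (simp add: mvn_density_eq[OF assms])
  qed
  then have "(\<integral>\<^sup>+ x. ennreal (mvn_density d \<theta> \<Sigma> x) \<partial>lborel_PiM d)
      = (\<integral>\<^sup>+ x. ennreal (1 / ?c) * ennreal (exp (- qform d (inv_mat \<Sigma>) x / 2)) \<partial>lborel_PiM d)"
    using det by (subst nn_integral_translate[symmetric, of _ d \<theta>]) (auto simp: ennreal_mult[symmetric])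
  also have "\<dots> = ennreal (1 / ?c) * (\<integral>\<^sup>+ x. ennreal (exp (- qform d (inv_mat \<Sigma>) x / 2)) \<partial>lborel_PiM d)"
    by (rule nn_integral_cmult) measurable
  also have "\<dots> = ennreal (1 / ?c) * ennreal ?c"
    using conjunct2[OF nn_integral_gaussian_qform[OF sym_pos_def_inv_mat[OF assms]]]
    by (simp add: det_inv_mat[OF assms])
  also have "\<dots> = 1"
    using det by (simp add: ennreal_mult[symmetric])
  finally show ?thesis .
qed

lemma prob_space_mvn:
  assumes "sym_pos_def d \<Sigma>"
  shows "prob_space (mvn d \<theta> \<Sigma>)"
proof
  note [measurable] = measurable_mvn_density'[OF assms]
  have "emeasure (mvn d \<theta> \<Sigma>) (space (lborel_PiM d)) = (\<integral>\<^sup>+ x. ennreal (mvn_density d \<theta> \<Sigma> x) \<partial>lborel_PiM d)"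
    unfolding mvn_def by (subst emeasure_density) (auto intro!: nn_integral_cong)
  then show "emeasure (mvn d \<theta> \<Sigma>) (space (mvn d \<theta> \<Sigma>)) = 1"
    using nn_integral_mvn_density[OF assms] by (simp add: mvn_def)
qed

lemma sets_mvn [measurable_cong, simp]: "sets (mvn d \<theta> \<Sigma>) = sets (lborel_PiM d)"
  by (simp add: mvn_def)

lemma space_mvn [simp]: "space (mvn d \<theta> \<Sigma>) = space (lborel_PiM d)"
  by (simp add: mvn_def)

lemma sigma_finite_lborel_PiM: "sigma_finite_measure (lborel_PiM d)"
proof -
  interpret product_sigma_finite "\<lambda>_::nat. lborel :: real measure" by standard
  show ?thesis by (rule sigma_finite) simp
qed

lemma iid_sample_mvn:
  assumes "sym_pos_def d \<Sigma>"
  shows "iid_sample n (mvn d \<theta> \<Sigma>)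
    = density (PiM {..<n} (\<lambda>_. lborel_PiM d)) (\<lambda>x. \<Prod>j<n. ennreal (mvn_density d \<theta> \<Sigma> (x j)))"
proof -
  note [measurable] = measurable_mvn_density'[OF assms]
  interpret product_sigma_finite "\<lambda>_::nat. lborel_PiM d"
    by (simp add: product_sigma_finite_def sigma_finite_lborel_PiM)
  show ?thesis
    unfolding iid_sample_def mvn_def
    by (rule PiM_density) (use prob_space_mvn[OF assms] in \<open>auto simp: mvn_def\<close>)
qed

text \<open>Exponential tilting: completing the square moves the mean by \<Sigma> u, and the cross
  term is the given linear one because \<Sigma>^-1 \<Sigma> u = u. Integration then yields the
  moment generating function.\<close>

lemma sum_mult_mvn_density:
  assumes "sym_pos_def d \<Sigma>"
  shows "exp (\<Sum>i<d. u i * (x i - \<theta> i)) * mvn_density d \<theta> \<Sigma> x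
    = exp (qform d \<Sigma> u / 2) * mvn_density d (\<lambda>i. \<theta> i + mat_apply d \<Sigma> u i) \<Sigma> x"
proof -
  have "qform d (inv_mat \<Sigma>) (\<lambda>i. x i - (\<theta> i + mat_apply d \<Sigma> u i))
      = qform d (inv_mat \<Sigma>) (\<lambda>i. (x i - \<theta> i) - mat_apply d \<Sigma> u i)"
    by (simp add: algebra_simps)
  also have "\<dots> = qform d (inv_mat \<Sigma>) (\<lambda>i. x i - \<theta> i)
      - 2 * (\<Sum>i<d. (x i - \<theta> i) * mat_apply d (inv_mat \<Sigma>) (mat_apply d \<Sigma> u) i) + qform d \<Sigma> u"
    by (simp add: qform_diff[OF sym_pos_def_inv_mat[OF assms]] qform_inverse[OF assms])
  also have "(\<Sum>i<d. (x i - \<theta> i) * mat_apply d (inv_mat \<Sigma>) (mat_apply d \<Sigma> u) i) = (\<Sum>i<d. u i * (x i - \<theta> i))"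
    by (intro sum.cong refl) (simp add: mat_apply_inverse[OF assms] mult.commute)
  finally show ?thesis
    by (simp add: mvn_density_eq[OF assms] exp_add[symmetric] field_simps)
qed

lemma nn_integral_exp_mvn:
  assumes "sym_pos_def d \<Sigma>"
  shows "(\<integral>\<^sup>+ x. ennreal (exp (\<Sum>i<d. u i * (x i - \<theta> i))) \<partial>mvn d \<theta> \<Sigma>) = ennreal (exp (qform d \<Sigma> u / 2))"
proof -
  note [measurable] = measurable_mvn_density'[OF assms]
  note [measurable] = measurable_component_lborel[of _ "{..<d}"]
  have "(\<integral>\<^sup>+ x. ennreal (exp (\<Sum>i<d. u i * (x i - \<theta> i))) \<partial>mvn d \<theta> \<Sigma>)
     = (\<integral>\<^sup>+ x. ennreal (mvn_density d \<theta> \<Sigma> x) * ennreal (exp (\<Sum>i<d. u i * (x i - \<theta> i))) \<partial>lborel_PiM d)"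
    unfolding mvn_def by (rule nn_integral_density) measurable
  also have "\<dots> = (\<integral>\<^sup>+ x. ennreal (exp (qform d \<Sigma> u / 2)) *
      ennreal (mvn_density d (\<lambda>i. \<theta> i + mat_apply d \<Sigma> u i) \<Sigma> x) \<partial>lborel_PiM d)"
    by (intro nn_integral_cong)
       (simp add: ennreal_mult[symmetric] mvn_density_nonneg[OF assms] sum_mult_mvn_density[OF assms, symmetric] mult.commute)
  also have "\<dots> = ennreal (exp (qform d \<Sigma> u / 2)) *
      (\<integral>\<^sup>+ x. ennreal (mvn_density d (\<lambda>i. \<theta> i + mat_apply d \<Sigma> u i) \<Sigma> x) \<partial>lborel_PiM d)"
    by (rule nn_integral_cmult) measurable
  finally show ?thesis by (simp add: nn_integral_mvn_density[OF assms])
qed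

subsection \<open>Translates under a Gaussian prior\<close>

locale gaussian_location =
  fixes d n :: nat and \<Sigma> :: "real mat"
  assumes spd: "sym_pos_def d \<Sigma>"
begin

abbreviation "sample_space \<equiv> PiM {..<n} (\<lambda>_. lborel_PiM d)"

abbreviation "sample_law \<theta> \<equiv> iid_sample n (mvn d \<theta> \<Sigma>)"

text \<open>The squared Mahalanobis length, the cost of a shift.\<close>

definition "precision = qform d (inv_mat \<Sigma>)"

text \<open>The prior has the covariance of a single observation and so acts like one more
  observation; this is the origin of n + 1 below.\<close>

definition joint_density :: "(nat \<Rightarrow> real) \<Rightarrow> (nat \<Rightarrow> nat \<Rightarrow> real) \<Rightarrow> real" where
  "joint_density \<theta> x = mvn_density d (\<lambda>_. 0) \<Sigma> \<theta> * (\<Prod>j<n. mvn_density d \<theta> \<Sigma> (x j))"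

definition joint :: "((nat \<Rightarrow> real) \<times> (nat \<Rightarrow> nat \<Rightarrow> real)) measure" where
  "joint = density (lborel_PiM d \<Otimes>\<^sub>M sample_space) (\<lambda>z. ennreal (joint_density (fst z) (snd z)))"

lemma sets_joint [measurable_cong, simp]: "sets joint = sets (lborel_PiM d \<Otimes>\<^sub>M sample_space)"
  by (simp add: joint_def)

lemma space_joint [simp]: "space joint = space (lborel_PiM d) \<times> space sample_space"
  by (simp add: joint_def space_pair_measure)

lemma sets_sample_law [measurable_cong, simp]: "sets (sample_law \<theta>) = sets sample_space"
  by (simp add: iid_sample_mvn[OF spd])

lemma space_sample_law [simp]: "space (sample_law \<theta>) = space sample_space"
  by (simp add: iid_sample_mvn[OF spd])

lemma prob_space_sample_law: "prob_space (sample_law \<theta>)"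
  unfolding iid_sample_def by (rule prob_space_PiM) (rule prob_space_mvn[OF spd])

lemma pair_sigma_finite_joint: "pair_sigma_finite (lborel_PiM d) sample_space"
proof -
  interpret product_sigma_finite "\<lambda>_::nat. lborel_PiM d"
    by (simp add: product_sigma_finite_def sigma_finite_lborel_PiM)
  show ?thesis
    by (intro pair_sigma_finite.intro sigma_finite_lborel_PiM sigma_finite) simp
qed

lemma measurable_sample_component:
  assumes "j < n" "i < d"
  shows "(\<lambda>x. x j i) \<in> borel_measurable sample_space"
  using measurable_compose[OF measurable_component_singleton[of j "{..<n}" "\<lambda>_. lborel_PiM d"]
      measurable_component_lborel[of i "{..<d}"]] assms by simp

lemma measurable_joint_density [measurable]:
  "(\<lambda>z. joint_density (fst z) (snd z)) \<in> borel_measurable (lborel_PiM d \<Otimes>\<^sub>M sample_space)"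
proof -
  have fst: "(\<lambda>z. fst z i) \<in> borel_measurable (lborel_PiM d \<Otimes>\<^sub>M sample_space)" if "i < d" for i
    using that by (intro measurable_compose[OF measurable_fst measurable_component_lborel]) simp
  have snd: "(\<lambda>z. snd z j i) \<in> borel_measurable (lborel_PiM d \<Otimes>\<^sub>M sample_space)" if "j < n" "i < d" for i j
    using that by (intro measurable_compose[OF measurable_snd measurable_sample_component]) simp
  show ?thesis
    unfolding joint_density_def
    by (intro borel_measurable_times borel_measurable_prod measurable_mvn_density[OF spd]) (auto intro: fst snd)
qed

lemma joint_density_nonneg: "0 \<le> joint_density \<theta> x"
  unfolding joint_density_def
  by (intro mult_nonneg_nonneg prod_nonneg ballI mvn_density_nonneg[OF spd])

text \<open>The hypotheses speak of residuals, point minus mean, so that one statement covers a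
  moving mean with a fixed observation as well as a moving point with mean zero.\<close>

lemma mvn_density_parallelogram:
  assumes "\<And>i. i < d \<Longrightarrow> xa i - \<theta>a i = y i" "\<And>i. i < d \<Longrightarrow> xb i - \<theta>b i = y i + h i"
    and "\<And>i. i < d \<Longrightarrow> xc i - \<theta>c i = y i - h i"
  shows "mvn_density d \<theta>b \<Sigma> xb * mvn_density d \<theta>c \<Sigma> xc
    = (mvn_density d \<theta>a \<Sigma> xa)\<^sup>2 * exp (- precision h)"
proof -
  let ?c = "sqrt ((2 * pi) ^ d * Determinant.det \<Sigma>)"
  have eq: "mvn_density d \<theta>a \<Sigma> xa = exp (- precision y / 2) / ?c"
    "mvn_density d \<theta>b \<Sigma> xb = exp (- precision (\<lambda>i. y i + h i) / 2) / ?c"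
    "mvn_density d \<theta>c \<Sigma> xc = exp (- precision (\<lambda>i. y i - h i) / 2) / ?c"
    unfolding mvn_density_eq[OF spd] precision_def
    by (simp_all add: assms cong: qform_cong)
  have "precision (\<lambda>i. y i + h i) + precision (\<lambda>i. y i - h i) = 2 * precision y + 2 * precision h"
    unfolding precision_def
    by (simp add: qform_add[OF sym_pos_def_inv_mat[OF spd]] qform_diff[OF sym_pos_def_inv_mat[OF spd]])
  then have "- precision (\<lambda>i. y i + h i) / 2 + - precision (\<lambda>i. y i - h i) / 2
      = - precision y / 2 + - precision y / 2 + - precision h"
    by (simp add: field_simps)
  then have "exp (- precision (\<lambda>i. y i + h i) / 2) * exp (- precision (\<lambda>i. y i - h i) / 2)
      = (exp (- precision y / 2))\<^sup>2 * exp (- precision h)"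
    by (simp only: exp_add[symmetric] power2_eq_square)
  then show ?thesis by (simp only: eq times_divide_times_eq power_divide power2_eq_square[of ?c]) simp
qed

text \<open>With g the density at \<theta> and q the cost of h, the product of the two translated
  densities is g^2 exp (- (n + 1) q): one exponential factor from the prior and n from the sample.
  The arithmetic-geometric mean inequality turns this into a bound on their sum.\<close>

lemma joint_density_translates:
  "2 * exp (- real (n + 1) * precision h / 2) * joint_density \<theta> x
     \<le> joint_density (translate d h \<theta>) x + joint_density (translate d (\<lambda>i. - h i) \<theta>) x"
proof -
  let ?p = "joint_density (translate d h \<theta>) x" and ?m = "joint_density (translate d (\<lambda>i. - h i) \<theta>) x"
  let ?e = "exp (- real (n + 1) * precision h / 2)"
  have sample: "mvn_density d (translate d h \<theta>) \<Sigma> (x j) * mvn_density d (translate d (\<lambda>i. - h i) \<theta>) \<Sigma> (x j)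
      = (mvn_density d \<theta> \<Sigma> (x j))\<^sup>2 * exp (- precision h)" for j
    \<comment> \<open>A mean moved by h has residual y - h, so the forward translate plays the role
      of \<open>\<theta>c\<close>.\<close>
    using mvn_density_parallelogram[where xb = "x j" and xc = "x j" and xa = "x j"
        and y = "\<lambda>i. x j i - \<theta> i" and h = h
        and \<theta>c = "translate d h \<theta>" and \<theta>b = "translate d (\<lambda>i. - h i) \<theta>" and \<theta>a = \<theta>]
    by (simp add: mult.commute)
  have "?p * ?m = (mvn_density d (\<lambda>_. 0) \<Sigma> (translate d h \<theta>) * mvn_density d (\<lambda>_. 0) \<Sigma> (translate d (\<lambda>i. - h i) \<theta>))
      * (\<Prod>j<n. mvn_density d (translate d h \<theta>) \<Sigma> (x j) * mvn_density d (translate d (\<lambda>i. - h i) \<theta>) \<Sigma> (x j))"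
    by (simp add: joint_density_def prod.distrib)
  also have "\<dots> = ((mvn_density d (\<lambda>_. 0) \<Sigma> \<theta>)\<^sup>2 * exp (- precision h))
      * (\<Prod>j<n. (mvn_density d \<theta> \<Sigma> (x j))\<^sup>2 * exp (- precision h))"
    unfolding sample by (subst mvn_density_parallelogram[where y = \<theta> and xa = \<theta> and \<theta>a = "\<lambda>_. 0" and h = h]) auto
  also have "\<dots> = (joint_density \<theta> x)\<^sup>2 * exp (- precision h) ^ (n + 1)"
    by (simp add: joint_density_def prod.distrib power_mult_distrib prod_power_distrib)
  also have "exp (- precision h) ^ (n + 1) = ?e\<^sup>2"
    by (simp add: exp_of_nat_mult[symmetric] power2_eq_square exp_add[symmetric] field_simps)
  finally have "(2 * ?e * joint_density \<theta> x)\<^sup>2 = 4 * (?p * ?m)"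
    by (simp add: power_mult_distrib)
  also have "\<dots> \<le> (?p + ?m)\<^sup>2"
    using sum_squares_ge_zero[of "?p - ?m" 0] by (simp add: power2_eq_square algebra_simps)
  finally show ?thesis
    by (rule power2_le_imp_le) (simp add: joint_density_nonneg)
qed

lemma emeasure_joint:
  assumes [measurable]: "E \<in> sets (lborel_PiM d \<Otimes>\<^sub>M sample_space)"
  shows "emeasure joint E
    = (\<integral>\<^sup>+ \<theta>. ennreal (mvn_density d (\<lambda>_. 0) \<Sigma> \<theta>) * emeasure (sample_law \<theta>) (Pair \<theta> -` E) \<partial>lborel_PiM d)"
proof -
  interpret pair_sigma_finite "lborel_PiM d" sample_space by (rule pair_sigma_finite_joint)
  note [measurable] = measurable_mvn_density'[OF spd]
  have "emeasure joint E = (\<integral>\<^sup>+ z. ennreal (joint_density (fst z) (snd z)) * indicator E z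
      \<partial>(lborel_PiM d \<Otimes>\<^sub>M sample_space))"
    unfolding joint_def by (rule emeasure_density) measurable
  also have "\<dots> = (\<integral>\<^sup>+ \<theta>. \<integral>\<^sup>+ x. ennreal (joint_density \<theta> x) * indicator E (\<theta>, x) \<partial>sample_space \<partial>lborel_PiM d)"
    by (subst M2.nn_integral_fst[symmetric]) auto
  also have "\<dots> = (\<integral>\<^sup>+ \<theta>. ennreal (mvn_density d (\<lambda>_. 0) \<Sigma> \<theta>) * emeasure (sample_law \<theta>) (Pair \<theta> -` E) \<partial>lborel_PiM d)"
  proof (rule nn_integral_cong)
    fix \<theta> assume "\<theta> \<in> space (lborel_PiM d)"
    have [measurable]: "Pair \<theta> -` E \<in> sets sample_space" using assms by (rule sets_Pair1)
    have "(\<integral>\<^sup>+ x. ennreal (joint_density \<theta> x) * indicator E (\<theta>, x) \<partial>sample_space)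
      = (\<integral>\<^sup>+ x. ennreal (mvn_density d (\<lambda>_. 0) \<Sigma> \<theta>) * ((\<Prod>j<n. ennreal (mvn_density d \<theta> \<Sigma> (x j)))
          * indicator (Pair \<theta> -` E) x) \<partial>sample_space)"
      by (intro nn_integral_cong)
         (simp add: joint_density_def ennreal_mult prod_ennreal mvn_density_nonneg[OF spd] prod_nonneg
           mult.assoc indicator_def)
    also have "\<dots> = ennreal (mvn_density d (\<lambda>_. 0) \<Sigma> \<theta>) * (\<integral>\<^sup>+ x. (\<Prod>j<n. ennreal (mvn_density d \<theta> \<Sigma> (x j)))
          * indicator (Pair \<theta> -` E) x \<partial>sample_space)"
      by (rule nn_integral_cmult) measurable
    also have "(\<integral>\<^sup>+ x. (\<Prod>j<n. ennreal (mvn_density d \<theta> \<Sigma> (x j))) * indicator (Pair \<theta> -` E) x \<partial>sample_space)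
        = emeasure (sample_law \<theta>) (Pair \<theta> -` E)"
      unfolding iid_sample_mvn[OF spd] by (rule emeasure_density[symmetric]) measurable
    finally show "(\<integral>\<^sup>+ x. ennreal (joint_density \<theta> x) * indicator E (\<theta>, x) \<partial>sample_space)
      = ennreal (mvn_density d (\<lambda>_. 0) \<Sigma> \<theta>) * emeasure (sample_law \<theta>) (Pair \<theta> -` E)" .
  qed
  finally show ?thesis .
qed

lemma emeasure_joint_space:
  "emeasure joint (space (lborel_PiM d) \<times> space sample_space) = 1"
proof -
  have "emeasure joint (space (lborel_PiM d) \<times> space sample_space)
      = (\<integral>\<^sup>+ \<theta>. ennreal (mvn_density d (\<lambda>_. 0) \<Sigma> \<theta>) \<partial>lborel_PiM d)"
  proof (subst emeasure_joint)
    show "space (lborel_PiM d) \<times> space sample_space \<in> sets (lborel_PiM d \<Otimes>\<^sub>M sample_space)"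
      by (rule pair_measureI) auto
    have "emeasure (sample_law \<theta>) (Pair \<theta> -` (space (lborel_PiM d) \<times> space sample_space)) = 1"
      if "\<theta> \<in> space (lborel_PiM d)" for \<theta>
      using prob_space.emeasure_space_1[OF prob_space_sample_law[of \<theta>]] that
      by simp
    then show "(\<integral>\<^sup>+ \<theta>. ennreal (mvn_density d (\<lambda>_. 0) \<Sigma> \<theta>) * emeasure (sample_law \<theta>)
          (Pair \<theta> -` (space (lborel_PiM d) \<times> space sample_space)) \<partial>lborel_PiM d)
        = (\<integral>\<^sup>+ \<theta>. ennreal (mvn_density d (\<lambda>_. 0) \<Sigma> \<theta>) \<partial>lborel_PiM d)"
      by (intro nn_integral_cong) simp
  qed
  then show ?thesis by (simp add: nn_integral_mvn_density[OF spd])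
qed

lemma prob_space_joint: "prob_space joint"
  by standard (simp add: emeasure_joint_space)

text \<open>Passage from the worst case to the Bayes model: a bound valid for every parameter
  survives averaging over the prior. Negative \<open>p\<close> is treated apart because
  \<open>ennreal\<close> truncates it to zero.\<close>

lemma le_measure_joint:
  assumes "E \<in> sets (lborel_PiM d \<Otimes>\<^sub>M sample_space)"
    and "\<And>\<theta>. \<theta> \<in> space (lborel_PiM d) \<Longrightarrow> p \<le> measure (sample_law \<theta>) (Pair \<theta> -` E)"
  shows "p \<le> measure joint E"
proof (cases "0 \<le> p")
  case True
  interpret J: prob_space joint by (rule prob_space_joint)
  note [measurable] = measurable_mvn_density'[OF spd]
  have "ennreal p = (\<integral>\<^sup>+ \<theta>. ennreal (mvn_density d (\<lambda>_. 0) \<Sigma> \<theta>) * ennreal p \<partial>lborel_PiM d)"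
    by (subst nn_integral_multc) (simp_all add: nn_integral_mvn_density[OF spd])
  also have "\<dots> \<le> emeasure joint E"
    unfolding emeasure_joint[OF assms(1)]
  proof (intro nn_integral_mono mult_left_mono)
    fix \<theta> assume "\<theta> \<in> space (lborel_PiM d)"
    interpret P: prob_space "sample_law \<theta>" by (rule prob_space_sample_law)
    show "ennreal p \<le> emeasure (sample_law \<theta>) (Pair \<theta> -` E)"
      unfolding P.emeasure_eq_measure using assms(2)[OF \<open>\<theta> \<in> _\<close>] by (rule ennreal_leI)
  qed simp
  finally show ?thesis by (simp add: J.emeasure_eq_measure)
next
  case False
  then show ?thesis by (meson less_imp_le linorder_not_less measure_nonneg order_trans)
qed

section \<open>Mass of translated events\<close>

lemma measurable_translate_fst [measurable]:
  "(\<lambda>z. (translate d h (fst z), snd z))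
     \<in> measurable (lborel_PiM d \<Otimes>\<^sub>M sample_space) (lborel_PiM d \<Otimes>\<^sub>M sample_space)"
  by (intro measurable_Pair measurable_compose[OF measurable_fst measurable_translate] measurable_snd)

text \<open>The event on the left is \<open>E\<close> moved by h in the parameter only. Substituting
  \<theta> + h for \<theta> returns the event to \<open>E\<close> and moves the density
  instead.\<close>

lemma emeasure_joint_translate:
  assumes [measurable]: "E \<in> sets (lborel_PiM d \<Otimes>\<^sub>M sample_space)"
  shows "emeasure joint {z \<in> space joint. (translate d (\<lambda>i. - h i) (fst z), snd z) \<in> E}
    = (\<integral>\<^sup>+ z. ennreal (joint_density (translate d h (fst z)) (snd z)) * indicator E z \<partial>(lborel_PiM d \<Otimes>\<^sub>M sample_space))"
proof -
  interpret pair_sigma_finite "lborel_PiM d" sample_space by (rule pair_sigma_finite_joint)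
  let ?S = "lborel_PiM d \<Otimes>\<^sub>M sample_space"
  let ?E = "{z \<in> space ?S. (translate d (\<lambda>i. - h i) (fst z), snd z) \<in> E}"
  have E: "?E \<in> sets ?S" by measurable
  define F where "F z = ennreal (joint_density (fst z) (snd z)) * indicator E (translate d (\<lambda>i. - h i) (fst z), snd z)" for z
  have F[measurable]: "F \<in> borel_measurable ?S"
    unfolding F_def by measurable
  have "emeasure joint ?E = (\<integral>\<^sup>+ z. ennreal (joint_density (fst z) (snd z)) * indicator ?E z \<partial>?S)"
    unfolding joint_def using E by (rule emeasure_density[rotated]) measurable
  also have "\<dots> = (\<integral>\<^sup>+ z. F z \<partial>?S)"
    by (intro nn_integral_cong) (auto simp: F_def indicator_def)
  \<comment> \<open>The parameter becomes the inner variable, so that translation invariance applies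
    with the sample held fixed.\<close>
  also have "\<dots> = (\<integral>\<^sup>+ x. \<integral>\<^sup>+ \<theta>. F (\<theta>, x) \<partial>lborel_PiM d \<partial>sample_space)"
    by (rule nn_integral_snd[symmetric]) measurable
  also have "\<dots> = (\<integral>\<^sup>+ x. \<integral>\<^sup>+ \<theta>. F (translate d h \<theta>, x) \<partial>lborel_PiM d \<partial>sample_space)"
    by (intro nn_integral_cong nn_integral_translate[symmetric] measurable_compose[OF _ F]) simp
  also have "\<dots> = (\<integral>\<^sup>+ z. F (translate d h (fst z), snd z) \<partial>?S)"
    by (subst nn_integral_snd[symmetric]) (auto intro!: measurable_compose[OF measurable_translate_fst F])
  also have "\<dots> = (\<integral>\<^sup>+ z. ennreal (joint_density (translate d h (fst z)) (snd z)) * indicator E z \<partial>?S)"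
    by (intro nn_integral_cong)
       (auto simp: F_def translate_translate translate_0 space_pair_measure space_PiM PiE_iff)
  finally show ?thesis by (simp add: joint_def)
qed

text \<open>The copies of \<open>E\<close> moved by h and by - h avoid \<open>E\<close> by the first
  condition, and avoid each other by the second since they are 2 h apart. All three fit into mass 1,
  and \<open>joint_density_translates\<close>, integrated over \<open>E\<close>, bounds the mass of
  the two copies from below.\<close>

lemma measure_joint_disjoint_translates:
  assumes E: "E \<in> sets (lborel_PiM d \<Otimes>\<^sub>M sample_space)"
    and disj1: "\<And>\<theta> x. (\<theta>, x) \<in> E \<Longrightarrow> (translate d h \<theta>, x) \<notin> E"
    and disj2: "\<And>\<theta> x. (\<theta>, x) \<in> E \<Longrightarrow> (translate d (\<lambda>i. h i + h i) \<theta>, x) \<notin> E"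
  shows "measure joint E * (1 + 2 * exp (- real (n + 1) * precision h / 2)) \<le> 1"
proof -
  interpret J: prob_space joint by (rule prob_space_joint)
  let ?S = "lborel_PiM d \<Otimes>\<^sub>M sample_space"
  let ?e = "exp (- real (n + 1) * precision h / 2)"
  define E1 where "E1 = {z \<in> space joint. (translate d (\<lambda>i. - h i) (fst z), snd z) \<in> E}"
  \<comment> \<open>The double negation lets \<open>emeasure_joint_translate\<close> match literally
    with the shift - h.\<close>
  define E2 where "E2 = {z \<in> space joint. (translate d (\<lambda>i. - (- h i)) (fst z), snd z) \<in> E}"
  note [measurable] = E
  have sets: "E1 \<in> sets joint" "E2 \<in> sets joint" "E \<in> sets joint"
    unfolding E1_def E2_def by (auto simp: joint_def)
  have tr: "translate d h (translate d (\<lambda>i. - h i) \<theta>) = \<theta>" if "\<theta> \<in> space (lborel_PiM d)" for \<theta>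
    using that by (simp add: translate_translate translate_0 space_PiM PiE_iff)
  have "E \<inter> E2 = {}" using disj1 by (auto simp: E2_def)
  moreover have "E \<inter> E1 = {}"
  proof -
    have "z \<notin> E" if "z \<in> E1" for z
      using that disj1[of "translate d (\<lambda>i. - h i) (fst z)" "snd z"] tr[of "fst z"] by (auto simp: E1_def)
    then show ?thesis by blast
  qed
  moreover have "E1 \<inter> E2 = {}"
  proof -
    have "z \<notin> E2" if "z \<in> E1" for z
      using that disj2[of "translate d (\<lambda>i. - h i) (fst z)" "snd z"]
      by (auto simp: E1_def E2_def translate_translate)
    then show ?thesis by blast
  qed
  ultimately have "measure joint E + (measure joint E1 + measure joint E2) \<le> 1"
    using sets J.finite_measure_Union[of E "E1 \<union> E2"] J.finite_measure_Union[of E1 E2]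
      J.prob_le_1[of "E \<union> (E1 \<union> E2)"] by (simp add: Int_Un_distrib)
  moreover have "2 * ?e * measure joint E \<le> measure joint E1 + measure joint E2"
  proof -
    let ?p = "\<lambda>z. joint_density (translate d h (fst z)) (snd z)"
    let ?m = "\<lambda>z. joint_density (translate d (\<lambda>i. - h i) (fst z)) (snd z)"
    have [measurable]: "?p \<in> borel_measurable ?S" "?m \<in> borel_measurable ?S"
      using measurable_compose[OF measurable_translate_fst measurable_joint_density] by simp_all
    have "ennreal (2 * ?e * measure joint E) = ennreal (2 * ?e) * emeasure joint E"
      by (simp add: J.emeasure_eq_measure ennreal_mult[symmetric])
    also have "\<dots> = (\<integral>\<^sup>+ z. ennreal (2 * ?e) * (ennreal (joint_density (fst z) (snd z)) * indicator E z) \<partial>?S)"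
      unfolding joint_def by (simp add: emeasure_density nn_integral_cmult)
    also have "\<dots> \<le> (\<integral>\<^sup>+ z. ennreal (?p z) * indicator E z + ennreal (?m z) * indicator E z \<partial>?S)"
    proof (rule nn_integral_mono)
      fix z
      show "ennreal (2 * ?e) * (ennreal (joint_density (fst z) (snd z)) * indicator E z)
          \<le> ennreal (?p z) * indicator E z + ennreal (?m z) * indicator E z"
        using joint_density_translates[of h "fst z" "snd z"]
        by (cases "z \<in> E")
           (simp_all add: ennreal_mult[symmetric] ennreal_plus[symmetric] joint_density_nonneg ennreal_leI
             del: ennreal_plus)
    qed
    also have "\<dots> = emeasure joint E1 + emeasure joint E2"
      unfolding E1_def E2_def emeasure_joint_translate[OF E]
      by (rule nn_integral_add) measurable
    also have "\<dots> = ennreal (measure joint E1 + measure joint E2)"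
      by (simp add: J.emeasure_eq_measure)
    finally show ?thesis by (subst (asm) ennreal_le_iff) auto
  qed
  ultimately show ?thesis by (simp add: algebra_simps)
qed

end

subsection \<open>Lower bounds on confidence radii\<close>

lemma vec_scalar_prod_L2_set:
  "sqrt (scalar_prod (Matrix.vec d x) (Matrix.vec d x)) = L2_set x {..<d}"
  by (simp add: scalar_prod_def L2_set_def power2_eq_square lessThan_atLeast0)

lemma mult_mat_vec_eq_mat_apply:
  assumes "A \<in> carrier_mat d d"
  shows "mult_mat_vec A (Matrix.vec d x) = Matrix.vec d (mat_apply d A x)"
  using assms by (auto simp: mat_apply_def scalar_prod_def lessThan_atLeast0 intro!: eq_vecI sum.cong)

lemma op_norm_eq:
  assumes "A \<in> carrier_mat d d"
  shows "op_norm A = (SUP x \<in> {x. L2_set x {..<d} \<le> 1}. L2_set (mat_apply d A x) {..<d})"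
proof -
  have "{v \<in> carrier_vec d. sqrt (scalar_prod v v) \<le> 1} = Matrix.vec d ` {x. L2_set x {..<d} \<le> 1}"
  proof -
    have "v \<in> Matrix.vec d ` {x. L2_set x {..<d} \<le> 1}" if v: "v \<in> carrier_vec d" "sqrt (scalar_prod v v) \<le> 1" for v
    proof -
      have "v = Matrix.vec d (vec_index v)" using v by auto
      then show ?thesis using v by (metis imageI mem_Collect_eq vec_scalar_prod_L2_set)
    qed
    moreover have "Matrix.vec d x \<in> {v \<in> carrier_vec d. sqrt (scalar_prod v v) \<le> 1}"
      if "L2_set x {..<d} \<le> 1" for x
      using that by (simp only: mem_Collect_eq vec_scalar_prod_L2_set vec_carrier)
    ultimately show ?thesis by blast
  qed
  then show ?thesis
    using assms
    by (simp add: op_norm_def image_image mult_mat_vec_eq_mat_apply vec_scalar_prod_L2_set)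
qed

lemma abs_le_L2_set: "finite I \<Longrightarrow> i \<in> I \<Longrightarrow> \<bar>x i\<bar> \<le> L2_set x I"
  using member_le_L2_set[of I i "\<lambda>i. \<bar>x i\<bar>"] by (simp add: L2_set_def)

text \<open>A real supremum is informative only for a bounded set. On the unit ball every coordinate
  is at most 1 in absolute value, so the sum of all absolute entries is a crude bound.\<close>

lemma bdd_above_op_norm:
  "bdd_above ((\<lambda>x. L2_set (mat_apply d A x) {..<d}) ` {x. L2_set x {..<d} \<le> 1})"
proof (rule bdd_aboveI2)
  fix x assume x: "x \<in> {x. L2_set x {..<d} \<le> 1}"
  have "L2_set (mat_apply d A x) {..<d} \<le> (\<Sum>i<d. \<bar>mat_apply d A x i\<bar>)"
    by (rule L2_set_le_sum_abs)
  also have "\<dots> \<le> (\<Sum>i<d. \<Sum>j<d. \<bar>A $$ (i, j)\<bar>)"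
  proof (rule sum_mono)
    fix i
    have "\<bar>mat_apply d A x i\<bar> \<le> (\<Sum>j<d. \<bar>A $$ (i, j) * x j\<bar>)"
      unfolding mat_apply_def by (rule sum_abs)
    also have "\<dots> \<le> (\<Sum>j<d. \<bar>A $$ (i, j)\<bar>)"
    proof (rule sum_mono)
      fix j assume "j \<in> {..<d}"
      then have "\<bar>x j\<bar> \<le> 1" using x abs_le_L2_set[of "{..<d}" j x] by auto
      then show "\<bar>A $$ (i, j) * x j\<bar> \<le> \<bar>A $$ (i, j)\<bar>"
        by (simp add: abs_mult mult_left_le)
    qed
    finally show "\<bar>mat_apply d A x i\<bar> \<le> (\<Sum>j<d. \<bar>A $$ (i, j)\<bar>)" .
  qed
  finally show "L2_set (mat_apply d A x) {..<d} \<le> (\<Sum>i<d. \<Sum>j<d. \<bar>A $$ (i, j)\<bar>)" .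
qed

lemma L2_set_mat_apply_le_op_norm:
  assumes "A \<in> carrier_mat d d" "L2_set x {..<d} \<le> 1"
  shows "L2_set (mat_apply d A x) {..<d} \<le> op_norm A"
  unfolding op_norm_eq[OF assms(1)] using assms(2) by (intro cSUP_upper bdd_above_op_norm) simp

text \<open>A near-maximiser stands in for a maximising vector; in the lower bound this costs only a
  constant factor.\<close>

lemma less_op_normE:
  assumes "A \<in> carrier_mat d d" "c < op_norm A"
  obtains x where "L2_set x {..<d} \<le> 1" "c < L2_set (mat_apply d A x) {..<d}"
proof -
  have "L2_set (\<lambda>_. 0 :: real) {..<d} \<le> 1" by (simp add: L2_set_def)
  then have "{x :: nat \<Rightarrow> real. L2_set x {..<d} \<le> 1} \<noteq> {}" by blast
  then show ?thesis
    using assms(2) that unfolding op_norm_eq[OF assms(1)]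
    by (subst (asm) less_cSUP_iff[OF _ bdd_above_op_norm]) auto
qed

lemma op_norm_pos:
  assumes "sym_pos_def d A" "1 \<le> d"
  shows "0 < op_norm A"
proof -
  let ?e = "\<lambda>i::nat. if i = 0 then 1 else 0 :: real"
  have "(\<Sum>i<d. (?e i)\<^sup>2) = (\<Sum>i<d. ?e i)" by (intro sum.cong) auto
  then have e: "(\<Sum>i<d. (?e i)\<^sup>2) = 1" using assms(2) by simp
  have "0 < A $$ (0, 0)" using sym_pos_def_diag_pos[OF assms(1), of 0] assms(2) by simp
  also have "A $$ (0, 0) = mat_apply d A ?e 0"
    using assms(2) by (simp add: mat_apply_def mult_delta_right)
  also have "\<dots> \<le> L2_set (mat_apply d A ?e) {..<d}"
    using abs_le_L2_set[of "{..<d}" 0 "mat_apply d A ?e"] assms(2) by simp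
  also have "\<dots> \<le> op_norm A"
    using sym_pos_def_carrier[OF assms(1)] e by (intro L2_set_mat_apply_le_op_norm) (simp_all add: L2_set_def)
  finally show ?thesis .
qed

lemma qform_le_L2_set_mat_apply: "qform d A x \<le> L2_set x {..<d} * L2_set (mat_apply d A x) {..<d}"
proof -
  have "qform d A x \<le> (\<Sum>i<d. \<bar>x i\<bar> * \<bar>mat_apply d A x i\<bar>)"
    unfolding qform_eq_sum by (rule sum_mono) (simp add: abs_mult[symmetric])
  also have "\<dots> \<le> L2_set x {..<d} * L2_set (mat_apply d A x) {..<d}" by (rule L2_set_mult_ineq)
  finally show ?thesis .
qed

lemma L2_set_cmult: "L2_set (\<lambda>i. c * x i) I = \<bar>c\<bar> * L2_set x I"
  by (simp add: L2_set_def power_mult_distrib sum_distrib_left[symmetric] real_sqrt_mult)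

text \<open>Cauchy-Schwarz for the normalised vector, then homogeneity of degree 2.\<close>

lemma qform_le_op_norm:
  assumes "A \<in> carrier_mat d d"
  shows "qform d A x \<le> op_norm A * (L2_set x {..<d})\<^sup>2"
proof (cases "L2_set x {..<d} = 0")
  case True
  then show ?thesis using qform_le_L2_set_mat_apply[of d A x] by simp
next
  case False
  define c where "c = L2_set x {..<d}"
  have c: "0 < c" using False L2_set_nonneg[of x "{..<d}"] unfolding c_def by linarith
  let ?u = "\<lambda>i. (1 / c) * x i"
  have u: "L2_set ?u {..<d} = 1" unfolding L2_set_cmult using c by (simp add: c_def)
  have "qform d A ?u \<le> 1 * L2_set (mat_apply d A ?u) {..<d}"
    using qform_le_L2_set_mat_apply[of d A ?u] unfolding u .
  also have "\<dots> \<le> op_norm A" using L2_set_mat_apply_le_op_norm[OF assms, of ?u] u by simp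
  finally show ?thesis
    unfolding qform_scale c_def[symmetric] using c by (simp add: power_divide field_simps)
qed

lemma mat_trace_eq: "A \<in> carrier_mat d d \<Longrightarrow> mat_trace A = (\<Sum>i<d. A $$ (i, i))"
  by (simp add: mat_trace_def)

lemma mat_trace_pos:
  assumes "sym_pos_def d A" "1 \<le> d"
  shows "0 < mat_trace A"
  unfolding mat_trace_eq[OF sym_pos_def_carrier[OF assms(1)]]
  using assms(2) by (intro sum_pos sym_pos_def_diag_pos[OF assms(1)]) (auto simp: lessThan_empty_iff)

lemma sq_loss_eq: "sq_loss d \<theta> \<theta>' = (\<Sum>i<d. (\<theta> i - \<theta>' i)\<^sup>2)"
  by (simp add: sq_loss_def L2_set_def sum_nonneg)

section \<open>The trace term and the operator norm term\<close>

context gaussian_location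
begin

lemma precision_mat_apply: "precision (mat_apply d \<Sigma> u) = qform d \<Sigma> u"
  by (simp add: precision_def qform_inverse[OF spd])

lemma measurable_estimator_error:
  assumes T: "T \<in> measurable sample_space (lborel_PiM d)" and i: "i < d"
  shows "(\<lambda>z. T (snd z) i - fst z i) \<in> borel_measurable (lborel_PiM d \<Otimes>\<^sub>M sample_space)"
proof -
  have "(\<lambda>z. T (snd z) i) \<in> borel_measurable (lborel_PiM d \<Otimes>\<^sub>M sample_space)"
    using measurable_compose[OF measurable_compose[OF measurable_snd T] measurable_component_lborel[of i]] i
    by simp
  moreover have "(\<lambda>z. fst z i) \<in> borel_measurable (lborel_PiM d \<Otimes>\<^sub>M sample_space)"
    using measurable_compose[OF measurable_fst measurable_component_lborel[of i]] i by simp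
  ultimately show ?thesis by (rule borel_measurable_diff)
qed

text \<open>
  Moving \<open>\<theta>\<close> by three radii in coordinate \<open>i\<close> along \<open>\<Sigma> e\<^sub>i\<close>, the cheapest
  direction for the precision form, makes the three events disjoint.
\<close>

lemma measure_joint_coordinate_le:
  assumes T: "T \<in> measurable sample_space (lborel_PiM d)" and i: "i < d" and n: "1 \<le> n"
  shows "measure joint {z \<in> space joint. \<bar>T (snd z) i - fst z i\<bar> \<le> sqrt (\<Sigma> $$ (i, i) / (90 * n))} \<le> 5 / 14"
proof -
  define t where "t = sqrt (\<Sigma> $$ (i, i) / (90 * n))"
  \<comment> \<open>The factor 3 makes h equal to 3 t in coordinate \<open>i\<close>, more than the
    width 2 t of the error interval, so moving by h or by 2 h leaves the event.\<close>
  define s where "s = 3 * t / \<Sigma> $$ (i, i)"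
  have \<Sigma>ii: "0 < \<Sigma> $$ (i, i)" using sym_pos_def_diag_pos[OF spd i] .
  have t: "0 < t" using \<Sigma>ii n by (simp add: t_def)
  define h where "h = mat_apply d \<Sigma> (\<lambda>k. if k = i then s else 0)"
  define E where "E = {z \<in> space joint. \<bar>T (snd z) i - fst z i\<bar> \<le> t}"
  note [measurable] = measurable_estimator_error[OF T i]
  have E: "E \<in> sets (lborel_PiM d \<Otimes>\<^sub>M sample_space)"
    unfolding E_def joint_def space_density by measurable
  have h: "h i = 3 * t"
    using i \<Sigma>ii by (simp add: h_def mat_apply_def s_def mult_delta_right)
  have "precision h = s * mat_apply d \<Sigma> (\<lambda>k. if k = i then s else 0) i"
    unfolding h_def precision_mat_apply qform_eq_sum using i by (simp add: mult_delta_left)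
  also have "\<dots> = s * (3 * t)" using h by (simp add: h_def)
  also have "\<dots> = 9 * t\<^sup>2 / \<Sigma> $$ (i, i)" by (simp add: s_def power2_eq_square)
  also have "t\<^sup>2 = \<Sigma> $$ (i, i) / (90 * n)" using \<Sigma>ii by (simp add: t_def)
  finally have q: "precision h = 1 / (10 * real n)" using \<Sigma>ii n by (simp add: field_simps)
  \<comment> \<open>As n \<ge> 1, the exponent (n + 1) / (20 n) is at most 1 / 10. With exp (- 1 /
    10) \<ge> 9 / 10 the bound on the probability becomes 1 / (1 + 9 / 5) = 5 / 14.\<close>
  have "- (1 / 10) \<le> - real (n + 1) * precision h / 2"
    using n by (simp add: q field_simps)
  then have "exp (- (1 / 10)) \<le> exp (- real (n + 1) * precision h / 2)" by simp
  moreover have "9 / 10 \<le> exp (- (1 / 10 :: real))" using exp_ge_add_one_self[of "- (1/10) :: real"] by simp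
  ultimately have e: "9 / 10 \<le> exp (- real (n + 1) * precision h / 2)" by linarith
  have "measure joint E * (1 + 2 * (9 / 10)) \<le> measure joint E * (1 + 2 * exp (- real (n + 1) * precision h / 2))"
    using e by (intro mult_left_mono) auto
  also have "\<dots> \<le> 1"
    by (rule measure_joint_disjoint_translates[OF E]) (use i h t in \<open>auto simp: E_def\<close>)
  finally show ?thesis by (simp add: E_def t_def)
qed

text \<open>If \<open>r\<close> were smaller, then on the confidence event the coordinates with
  small error would carry at least 3 / 4 of the weight \<Sigma>_ii. That event has mass at least 3 /
  4, so the expected weight fraction would be at least 9 / 16, whereas the coordinate bounds allow
  at most 5 / 14.\<close>

lemma confidence_radius_ge_trace:
  assumes T: "T \<in> measurable sample_space (lborel_PiM d)" and "1 \<le> n" "1 \<le> d" "\<delta> \<le> 1 / 4"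
    and conf: "\<And>\<theta>. \<theta> \<in> space (lborel_PiM d) \<Longrightarrow>
      1 - \<delta> \<le> measure (sample_law \<theta>) {x \<in> space sample_space. sq_loss d (T x) \<theta> \<le> r}"
  shows "mat_trace \<Sigma> / (360 * n) \<le> r"
proof (rule ccontr)
  assume r: "\<not> ?thesis"
  interpret J: prob_space joint by (rule prob_space_joint)
  let ?tr = "mat_trace \<Sigma>"
  define A where "A i = {z \<in> space joint. \<bar>T (snd z) i - fst z i\<bar> \<le> sqrt (\<Sigma> $$ (i, i) / (90 * n))}" for i
  define E where "E = {z \<in> space joint. sq_loss d (T (snd z)) (fst z) \<le> r}"
  note [measurable] = measurable_estimator_error[OF T]
  have E: "E \<in> sets (lborel_PiM d \<Otimes>\<^sub>M sample_space)"
    unfolding E_def joint_def space_density sq_loss_eq by measurable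
  have A: "A i \<in> sets joint" if "i < d" for i
    using that unfolding A_def by measurable
  have tr: "0 < ?tr" using mat_trace_pos[OF spd] assms by simp
  have "Pair \<theta> -` E = {x \<in> space sample_space. sq_loss d (T x) \<theta> \<le> r}" if "\<theta> \<in> space (lborel_PiM d)" for \<theta>
    using that by (auto simp: E_def)
  then have QE: "3 / 4 \<le> measure joint E"
    using le_measure_joint[OF E, of "1 - \<delta>"] conf assms(4) by fastforce
  have pointwise: "3 / 4 * ?tr * indicator E z \<le> (\<Sum>i<d. \<Sigma> $$ (i, i) * indicator (A i) z)" for z
  proof (cases "z \<in> E")
    case True
    \<comment> \<open>A Markov argument over coordinates: outside \<open>A i\<close> the weight is
      at most 90 n times the squared error. Summing, the missing weight is at most 90 n r, which is
      a quarter of the trace at the threshold because 360 = 4 * 90.\<close>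
    have "(\<Sum>i<d. \<Sigma> $$ (i, i) * (1 - indicator (A i) z)) \<le> (\<Sum>i<d. 90 * n * (T (snd z) i - fst z i)\<^sup>2)"
    proof (rule sum_mono)
      fix i assume "i \<in> {..<d}"
      show "\<Sigma> $$ (i, i) * (1 - indicator (A i) z) \<le> 90 * n * (T (snd z) i - fst z i)\<^sup>2"
      proof (cases "z \<in> A i")
        case False
        then have "sqrt (\<Sigma> $$ (i, i) / (90 * n)) \<le> \<bar>T (snd z) i - fst z i\<bar>"
          using True by (auto simp: A_def E_def)
        then have "sqrt (\<Sigma> $$ (i, i) / (90 * n)) \<le> sqrt ((T (snd z) i - fst z i)\<^sup>2)" by simp
        then have "\<Sigma> $$ (i, i) / (90 * n) \<le> (T (snd z) i - fst z i)\<^sup>2"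
          by (simp only: real_sqrt_le_iff)
        then show ?thesis using False assms(2) by (simp add: field_simps)
      qed simp
    qed
    also have "\<dots> = 90 * n * sq_loss d (T (snd z)) (fst z)"
      by (simp add: sq_loss_eq sum_distrib_left)
    also have "\<dots> \<le> 90 * n * r" using True by (intro mult_left_mono) (auto simp: E_def)
    also have "\<dots> \<le> ?tr / 4" using r assms(2) by (simp add: field_simps)
    finally have "?tr - (\<Sum>i<d. \<Sigma> $$ (i, i) * indicator (A i) z) \<le> ?tr / 4"
      by (simp add: mat_trace_eq[OF sym_pos_def_carrier[OF spd]] algebra_simps sum_subtractf)
    then show ?thesis using True by simp
  next
    case False
    have "0 \<le> (\<Sum>i<d. \<Sigma> $$ (i, i) * indicator (A i) z)"
      using sym_pos_def_diag_pos[OF spd] by (intro sum_nonneg mult_nonneg_nonneg) (simp_all add: less_imp_le)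
    then show ?thesis using False by simp
  qed
  have intA: "integrable joint (\<lambda>z. \<Sigma> $$ (i, i) * indicator (A i) z :: real)" if "i < d" for i
    using A[OF that] by (intro integrable_mult_right integrable_real_indicator) (simp_all add: J.emeasure_eq_measure)
  have intE: "integrable joint (\<lambda>z. 3 / 4 * ?tr * indicator E z :: real)"
    using E by (intro integrable_mult_right integrable_real_indicator) (simp_all add: J.emeasure_eq_measure)
  have "3 / 4 * ?tr * measure joint E = (\<integral>z. 3 / 4 * ?tr * indicator E z \<partial>joint)"
    using E sets.sets_into_space[of E joint] by (simp add: Int_absorb2)
  also have "\<dots> \<le> (\<integral>z. (\<Sum>i<d. \<Sigma> $$ (i, i) * indicator (A i) z) \<partial>joint)"
    
    by (intro integral_mono pointwise intE Bochner_Integration.integrable_sum intA) simp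
  also have "\<dots> = (\<Sum>i<d. \<Sigma> $$ (i, i) * measure joint (A i))"
  proof -
    have "A i \<inter> space joint = A i" for i by (auto simp: A_def)
    then have eq: "(\<integral>z. \<Sigma> $$ (i, i) * indicator (A i) z \<partial>joint) = \<Sigma> $$ (i, i) * measure joint (A i)" for i
      by (simp only: integral_mult_right_zero Bochner_Integration.integral_indicator)
    have "(\<integral>z. (\<Sum>i<d. \<Sigma> $$ (i, i) * indicator (A i) z) \<partial>joint)
        = (\<Sum>i<d. \<integral>z. \<Sigma> $$ (i, i) * indicator (A i) z \<partial>joint)"
      by (rule Bochner_Integration.integral_sum) (rule intA, simp)
    then show ?thesis by (simp only: eq)
  qed
  also have "\<dots> \<le> (\<Sum>i<d. \<Sigma> $$ (i, i) * (5 / 14))"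
    using measure_joint_coordinate_le[OF T _ assms(2)] sym_pos_def_diag_pos[OF spd]
    by (intro sum_mono mult_left_mono) (auto simp: A_def less_imp_le)
  also have "\<dots> = 5 / 14 * ?tr"
    by (simp add: mat_trace_eq[OF sym_pos_def_carrier[OF spd]] sum_distrib_left mult.commute)
  finally have "3 / 4 * measure joint E \<le> 5 / 14"
    using tr by (simp add: field_simps)
  then show False using QE by simp
qed

text \<open>A shift h longer than twice the radius separates the confidence events, and along the
  chosen direction its cost is at most ln (1 / \<delta>) / n. The translates then weigh at least
  \<delta> each relative to the event, and (1 - \<delta>) (1 + 2 \<delta>) = 1 + \<delta> (1 - 2
  \<delta>) exceeds 1.\<close>

lemma confidence_radius_ge_op_norm:
  assumes T: "T \<in> measurable sample_space (lborel_PiM d)" and "1 \<le> n" "1 \<le> d" "0 < \<delta>" "\<delta> \<le> 1 / 4"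
    and conf: "\<And>\<theta>. \<theta> \<in> space (lborel_PiM d) \<Longrightarrow>
      1 - \<delta> \<le> measure (sample_law \<theta>) {x \<in> space sample_space. sq_loss d (T x) \<theta> \<le> r}"
  shows "op_norm \<Sigma> * ln (1 / \<delta>) / (10 * n) \<le> r"
proof (rule ccontr)
  assume less: "\<not> ?thesis"
  interpret J: prob_space joint by (rule prob_space_joint)
  \<comment> \<open>The event is enlarged from radius \<open>r\<close> to \<open>R\<close>, which
    keeps its coverage; \<open>R\<close> is positive, whereas \<open>r\<close> might not be.\<close>
  define R where "R = op_norm \<Sigma> * ln (1 / \<delta>) / (10 * n)"
  have rR: "r \<le> R" using less by (simp add: R_def)
  have op: "0 < op_norm \<Sigma>" using op_norm_pos[OF spd] assms by simp
  have R: "0 < R" unfolding R_def using op assms by (intro divide_pos_pos mult_pos_pos) auto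
  obtain v where v: "L2_set v {..<d} \<le> 1" "op_norm \<Sigma> / 2 < L2_set (mat_apply d \<Sigma> v) {..<d}"
    using less_op_normE[OF sym_pos_def_carrier[OF spd], of "op_norm \<Sigma> / 2"] op by auto
  define m where "m = L2_set (mat_apply d \<Sigma> v) {..<d}"
  have m: "0 < m" "op_norm \<Sigma> / 2 < m" using v op by (auto simp: m_def)
  \<comment> \<open>This scaling gives h the length sqrt (5 R), just above the distance 2 sqrt R up
    to which two balls of radius sqrt R can meet.\<close>
  define t where "t = sqrt (5 * R) / m"
  define h where "h = mat_apply d \<Sigma> (\<lambda>i. t * v i)"
  have "L2_set h {..<d} = L2_set (\<lambda>i. t * mat_apply d \<Sigma> v i) {..<d}"
    by (simp add: h_def mat_apply_scale cong: L2_set_cong)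
  also have "\<dots> = sqrt (5 * R)" unfolding L2_set_cmult m_def[symmetric] using m R by (simp add: t_def)
  finally have h: "L2_set h {..<d} = sqrt (5 * R)" .
  have "precision h = t\<^sup>2 * qform d \<Sigma> v"
    unfolding h_def precision_mat_apply qform_scale ..
  also have "\<dots> \<le> t\<^sup>2 * m"
  proof (rule mult_left_mono)
    have "qform d \<Sigma> v \<le> L2_set v {..<d} * m" unfolding m_def by (rule qform_le_L2_set_mat_apply)
    also have "\<dots> \<le> 1 * m" using v m by (intro mult_right_mono) auto
    finally show "qform d \<Sigma> v \<le> m" by simp
  qed simp
  also have "\<dots> = 5 * R / m" using m R by (simp add: t_def power_divide power2_eq_square)
  \<comment> \<open>The near-maximiser loses a factor 2, and 2 * 5 is the 10 in the definition of
    \<open>R\<close>.\<close>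
  also have "\<dots> \<le> 5 * R / (op_norm \<Sigma> / 2)"
    using m op R by (intro divide_left_mono) auto
  also have "\<dots> = ln (1 / \<delta>) / n" using op assms(2) by (simp add: R_def field_simps)
  finally have "real (n + 1) * precision h / 2 \<le> real (n + 1) * (ln (1 / \<delta>) / n) / 2"
    by (intro divide_right_mono mult_left_mono) auto
  \<comment> \<open>Here n \<ge> 1 enters as n + 1 \<le> 2 n.\<close>
  also have "\<dots> \<le> ln (1 / \<delta>)"
  proof -
    have "0 \<le> ln (1 / \<delta>)" using assms by simp
    then have "real (n + 1) * ln (1 / \<delta>) \<le> (2 * n) * ln (1 / \<delta>)"
      using assms(2) by (intro mult_right_mono) auto
    then show ?thesis using assms(2) by (simp add: field_simps)
  qed
  finally have "- ln (1 / \<delta>) \<le> - real (n + 1) * precision h / 2" by (simp add: algebra_simps)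
  then have "exp (- ln (1 / \<delta>)) \<le> exp (- real (n + 1) * precision h / 2)" by (simp only: exp_le_cancel_iff)
  then have e: "\<delta> \<le> exp (- real (n + 1) * precision h / 2)"
    using assms by (simp add: ln_div)
  define E where "E = {z \<in> space joint. sq_loss d (T (snd z)) (fst z) \<le> R}"
  note [measurable] = measurable_estimator_error[OF T]
  have E: "E \<in> sets (lborel_PiM d \<Otimes>\<^sub>M sample_space)"
    unfolding E_def joint_def space_density sq_loss_eq by measurable
  have QE: "1 - \<delta> \<le> measure joint E"
  proof (rule le_measure_joint[OF E])
    fix \<theta> assume \<theta>: "\<theta> \<in> space (lborel_PiM d)"
    interpret P: prob_space "sample_law \<theta>" by (rule prob_space_sample_law)
    note conf[OF \<theta>]
    also have "measure (sample_law \<theta>) {x \<in> space sample_space. sq_loss d (T x) \<theta> \<le> r}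
        \<le> measure (sample_law \<theta>) (Pair \<theta> -` E)"
      using \<theta> rR sets_Pair1[OF E, of \<theta>] by (intro P.finite_measure_mono) (auto simp: E_def)
    finally show "1 - \<delta> \<le> measure (sample_law \<theta>) (Pair \<theta> -` E)" .
  qed
  \<comment> \<open>The cases c = 1 and c = 2 give the two disjointness conditions. If \<theta> and
    \<theta> + c h were both within sqrt R of the estimate, the triangle inequality would bound c h
    by 2 sqrt R.\<close>
  have far: "(translate d (\<lambda>i. c * h i) \<theta>, x) \<notin> E" if "(\<theta>, x) \<in> E" "1 \<le> c" for \<theta> x c
  proof
    assume "(translate d (\<lambda>i. c * h i) \<theta>, x) \<in> E"
    then have "L2_set (\<lambda>i. T x i - translate d (\<lambda>i. c * h i) \<theta> i) {..<d} \<le> sqrt R"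
      by (intro real_le_rsqrt) (simp add: E_def sq_loss_def)
    moreover have "L2_set (\<lambda>i. T x i - translate d (\<lambda>i. c * h i) \<theta> i) {..<d}
        = L2_set (\<lambda>i. T x i - (\<theta> i + c * h i)) {..<d}"
      by (rule L2_set_cong) auto
    ultimately have a: "L2_set (\<lambda>i. T x i - (\<theta> i + c * h i)) {..<d} \<le> sqrt R" by simp
    have b: "L2_set (\<lambda>i. T x i - \<theta> i) {..<d} \<le> sqrt R"
      using that(1) by (intro real_le_rsqrt) (simp add: E_def sq_loss_def)
    have "sqrt (5 * R) \<le> c * sqrt (5 * R)" using that(2) R by simp
    also have "\<dots> = L2_set (\<lambda>i. c * h i) {..<d}"
      using that(2) by (simp add: L2_set_cmult h)
    also have "\<dots> = L2_set (\<lambda>i. (T x i - \<theta> i) + - 1 * (T x i - (\<theta> i + c * h i))) {..<d}"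
      by simp
    also have "\<dots> \<le> L2_set (\<lambda>i. T x i - \<theta> i) {..<d} + L2_set (\<lambda>i. - 1 * (T x i - (\<theta> i + c * h i))) {..<d}"
      by (rule L2_set_triangle_ineq)
    also have "\<dots> \<le> 2 * sqrt R" unfolding L2_set_cmult using a b by simp
    also have "\<dots> = sqrt (4 * R)" by (simp add: real_sqrt_mult)
    finally show False using R by simp
  qed
  have "(1 - \<delta>) * (1 + 2 * \<delta>) \<le> measure joint E * (1 + 2 * exp (- real (n + 1) * precision h / 2))"
    using QE e assms by (intro mult_mono) auto
  also have "\<dots> \<le> 1"
    by (rule measure_joint_disjoint_translates[OF E]) (use far[of _ _ 1] far[of _ _ 2] in auto)
  finally have "\<delta> * (1 - 2 * \<delta>) \<le> 0" by (simp add: algebra_simps)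
  moreover have "0 < \<delta> * (1 - 2 * \<delta>)" using assms by simp
  ultimately show False by simp
qed

end

subsection \<open>Tail bound for the sample mean\<close>

text \<open>This is N(0, \<sigma>^2 I), the mixing law of the direction u. The product encoding lets
  moments factor over the coordinates.\<close>

definition gaussian_PiM :: "nat \<Rightarrow> real \<Rightarrow> (nat \<Rightarrow> real) measure" where
  "gaussian_PiM d \<sigma> = PiM {..<d} (\<lambda>_. density lborel (normal_density 0 \<sigma>))"

lemma product_prob_space_normal:
  "0 < \<sigma> \<Longrightarrow> product_prob_space (\<lambda>_::nat. density lborel (normal_density 0 \<sigma>))"
  by (simp add: product_prob_spaceI prob_space_normal_density)

lemma prob_space_gaussian_PiM: "0 < \<sigma> \<Longrightarrow> prob_space (gaussian_PiM d \<sigma>)"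
  unfolding gaussian_PiM_def by (intro prob_space_PiM prob_space_normal_density)

lemma sets_gaussian_PiM [measurable_cong, simp]: "sets (gaussian_PiM d \<sigma>) = sets (lborel_PiM d)"
  unfolding gaussian_PiM_def by (intro sets_PiM_cong) auto

lemma gaussian_PiM_density:
  assumes "0 < \<sigma>"
  shows "gaussian_PiM d \<sigma> = density (lborel_PiM d) (\<lambda>u. \<Prod>i<d. ennreal (normal_density 0 \<sigma> (u i)))"
proof -
  interpret product_sigma_finite "\<lambda>_::nat. lborel :: real measure" by standard
  show ?thesis
    unfolding gaussian_PiM_def using assms by (intro PiM_density prob_space_normal_density) auto
qed

lemma normal_first_moment:
  assumes "0 < \<sigma>"
  shows "integrable (density lborel (normal_density 0 \<sigma>)) (\<lambda>x. x)"
    "(\<integral>x. x \<partial>density lborel (normal_density 0 \<sigma>)) = 0"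
  using integrable_normal_moment_nz_1[OF assms, of 0] integral_normal_moment_nz_1[OF assms, of 0]
  by (simp_all add: integrable_real_density integral_real_density)

lemma normal_second_moment:
  assumes "0 < \<sigma>"
  shows "integrable (density lborel (normal_density 0 \<sigma>)) (\<lambda>x. x * x)"
    "(\<integral>x. x * x \<partial>density lborel (normal_density 0 \<sigma>)) = \<sigma>\<^sup>2"
  using integrable_normal_moment[OF assms, of 0 2] integral_normal_moment_even[OF assms, of 0 1]
  by (simp_all add: integrable_real_density integral_real_density power2_eq_square fact_numeral)

lemma gaussian_PiM_first_moment:
  assumes "0 < \<sigma>" "i < d"
  shows "integrable (gaussian_PiM d \<sigma>) (\<lambda>u. u i)" "(\<integral>u. u i \<partial>gaussian_PiM d \<sigma>) = 0"
proof -
  interpret product_prob_space "\<lambda>_::nat. density lborel (normal_density 0 \<sigma>)"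
    using assms(1) by (rule product_prob_space_normal)
  \<comment> \<open>A single coordinate is written as a product over all coordinates, with 1 in the
    other places, so that the product integral formula applies.\<close>
  let ?f = "\<lambda>k x. if k = i then x else (1 :: real)"
  have int: "integrable (density lborel (normal_density 0 \<sigma>)) (?f k)" for k
    using normal_first_moment(1)[OF assms(1)] by (cases "k = i") auto
  have eq: "(\<Prod>k<d. ?f k (u k)) = u i" for u :: "nat \<Rightarrow> real"
    using assms(2) by simp
  show "integrable (gaussian_PiM d \<sigma>) (\<lambda>u. u i)"
    using product_integrable_prod[of "{..<d}" ?f] int by (simp add: gaussian_PiM_def eq)
  have "(\<integral>u. u i \<partial>gaussian_PiM d \<sigma>) = (\<Prod>k<d. \<integral>x. ?f k x \<partial>density lborel (normal_density 0 \<sigma>))"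
    using product_integral_prod[of "{..<d}" ?f] int by (simp add: gaussian_PiM_def eq)
  also have "\<dots> = 0"
    using assms normal_first_moment(2)[OF assms(1)] by (intro prod_zero bexI[of _ i]) auto
  finally show "(\<integral>u. u i \<partial>gaussian_PiM d \<sigma>) = 0" .
qed

lemma gaussian_PiM_second_moment:
  assumes "0 < \<sigma>" "i < d" "j < d"
  shows "integrable (gaussian_PiM d \<sigma>) (\<lambda>u. u i * u j)"
    "(\<integral>u. u i * u j \<partial>gaussian_PiM d \<sigma>) = (if i = j then \<sigma>\<^sup>2 else 0)"
proof -
  interpret product_prob_space "\<lambda>_::nat. density lborel (normal_density 0 \<sigma>)"
    using assms(1) by (rule product_prob_space_normal)
  \<comment> \<open>The two conditionals multiply to the square of \<open>x\<close> when i = j, so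
    one family of factors serves both cases.\<close>
  let ?f = "\<lambda>k x. (if k = i then x else (1 :: real)) * (if k = j then x else 1)"
  have int: "integrable (density lborel (normal_density 0 \<sigma>)) (?f k)" for k
    using normal_first_moment(1)[OF assms(1)] normal_second_moment(1)[OF assms(1)]
    by (cases "k = i"; cases "k = j") auto
  have eq: "(\<Prod>k<d. ?f k (u k)) = u i * u j" for u :: "nat \<Rightarrow> real"
    using assms(2,3) by (simp add: prod.distrib)
  show "integrable (gaussian_PiM d \<sigma>) (\<lambda>u. u i * u j)"
    using product_integrable_prod[of "{..<d}" ?f] int by (simp only: gaussian_PiM_def eq finite_lessThan)
  have int_eq: "(\<integral>u. u i * u j \<partial>gaussian_PiM d \<sigma>) = (\<Prod>k<d. \<integral>x. ?f k x \<partial>density lborel (normal_density 0 \<sigma>))"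
    using product_integral_prod[of "{..<d}" ?f] int by (simp only: gaussian_PiM_def eq finite_lessThan)
  show "(\<integral>u. u i * u j \<partial>gaussian_PiM d \<sigma>) = (if i = j then \<sigma>\<^sup>2 else 0)"
  proof (cases "i = j")
    case True
    have "(\<integral>x. ?f k x \<partial>density lborel (normal_density 0 \<sigma>)) = (if k = i then \<sigma>\<^sup>2 else 1)" for k
      using True normal_second_moment(2)[OF assms(1)]
        prob_space.prob_space[OF prob_space_normal_density[OF assms(1)], of 0] by auto
    then show ?thesis unfolding int_eq using True assms(2) by simp
  next
    case False
    have "(\<integral>x. ?f i x \<partial>density lborel (normal_density 0 \<sigma>)) = 0"
      using False normal_first_moment(2)[OF assms(1)] by simp
    then show ?thesis unfolding int_eq using False assms(2) by (auto intro!: prod_zero bexI[of _ i])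
  qed
qed

text \<open>The Cameron-Martin formula in finite dimension: the exponential is the ratio of the
  densities at u + a and at u.\<close>

lemma nn_integral_gaussian_PiM_translate:
  assumes "0 < \<sigma>" and [measurable]: "F \<in> borel_measurable (lborel_PiM d)"
  shows "(\<integral>\<^sup>+ u. F u \<partial>gaussian_PiM d \<sigma>)
    = (\<integral>\<^sup>+ u. F (translate d a u) * ennreal (exp (- (\<Sum>i<d. 2 * u i * a i + (a i)\<^sup>2) / (2 * \<sigma>\<^sup>2))) \<partial>gaussian_PiM d \<sigma>)"
proof -
  note [measurable] = measurable_component_lborel[of _ "{..<d}"]
  define p where "p u = (\<Prod>i<d. ennreal (normal_density 0 \<sigma> (u i)))" for u
  define r where "r u = exp (- (\<Sum>i<d. 2 * u i * a i + (a i)\<^sup>2) / (2 * \<sigma>\<^sup>2))" for u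
  have [measurable]: "p \<in> borel_measurable (lborel_PiM d)" "r \<in> borel_measurable (lborel_PiM d)"
    unfolding p_def r_def by measurable
  have p: "p (translate d a u) = p u * ennreal (r u)" for u
  proof -
    have one: "normal_density 0 \<sigma> (u i + a i) = normal_density 0 \<sigma> (u i) * exp (- (2 * u i * a i + (a i)\<^sup>2) / (2 * \<sigma>\<^sup>2))" for i
      using assms(1)
      by (simp add: normal_density_def exp_add[symmetric] power2_eq_square diff_divide_distrib[symmetric] add_divide_distrib[symmetric] algebra_simps)
    have "p (translate d a u) = (\<Prod>i<d. ennreal (normal_density 0 \<sigma> (u i) * exp (- (2 * u i * a i + (a i)\<^sup>2) / (2 * \<sigma>\<^sup>2))))"
      unfolding p_def by (intro prod.cong refl) (simp add: one)
    also have "\<dots> = p u * (\<Prod>i<d. ennreal (exp (- (2 * u i * a i + (a i)\<^sup>2) / (2 * \<sigma>\<^sup>2))))"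
      by (simp add: ennreal_mult p_def prod.distrib)
    also have "(\<Prod>i<d. ennreal (exp (- (2 * u i * a i + (a i)\<^sup>2) / (2 * \<sigma>\<^sup>2)))) = ennreal (r u)"
      by (simp add: prod_ennreal exp_sum[symmetric] r_def sum_divide_distrib[symmetric] sum_negf[symmetric] del: sum_negf)
    finally show ?thesis .
  qed
  have "(\<integral>\<^sup>+ u. F u \<partial>gaussian_PiM d \<sigma>) = (\<integral>\<^sup>+ u. p u * F u \<partial>lborel_PiM d)"
    unfolding gaussian_PiM_density[OF assms(1)] p_def[symmetric] by (rule nn_integral_density) measurable
  also have "\<dots> = (\<integral>\<^sup>+ u. p (translate d a u) * F (translate d a u) \<partial>lborel_PiM d)"
    by (rule nn_integral_translate[symmetric]) measurable
  also have "\<dots> = (\<integral>\<^sup>+ u. p u * (F (translate d a u) * ennreal (r u)) \<partial>lborel_PiM d)"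
    unfolding p by (simp add: mult_ac)
  also have "\<dots> = (\<integral>\<^sup>+ u. F (translate d a u) * ennreal (r u) \<partial>gaussian_PiM d \<sigma>)"
    unfolding gaussian_PiM_density[OF assms(1)] p_def[symmetric] by (rule nn_integral_density[symmetric]) measurable
  finally show ?thesis by (simp add: r_def)
qed

text \<open>Jensen's inequality for exp: the linear term has mean zero and the quadratic form has
  mean \<sigma>^2 tr A. An infinite integral makes the claim trivial.\<close>

lemma gaussian_PiM_jensen:
  assumes "0 < \<sigma>"
  shows "ennreal (exp (- \<sigma>\<^sup>2 * (\<Sum>i<d. A $$ (i, i)) / 2))
    \<le> (\<integral>\<^sup>+ u. ennreal (exp ((\<Sum>i<d. c i * u i) - qform d A u / 2)) \<partial>gaussian_PiM d \<sigma>)"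
proof -
  interpret prob_space "gaussian_PiM d \<sigma>" using assms by (rule prob_space_gaussian_PiM)
  note first = gaussian_PiM_first_moment[OF assms]
  note second = gaussian_PiM_second_moment[OF assms]
  define Y where "Y u = (\<Sum>i<d. c i * u i) - (\<Sum>i<d. \<Sum>j<d. A $$ (i, j) / 2 * (u i * u j))" for u
  have Y: "(\<Sum>i<d. c i * u i) - qform d A u / 2 = Y u" for u
    by (simp add: Y_def qform_def sum_divide_distrib algebra_simps)
  have "has_bochner_integral (gaussian_PiM d \<sigma>) Y
      ((\<Sum>i<d. c i * 0) - (\<Sum>i<d. \<Sum>j<d. A $$ (i, j) / 2 * (if i = j then \<sigma>\<^sup>2 else 0)))"
    unfolding Y_def
    by (intro has_bochner_integral_diff has_bochner_integral_sum has_bochner_integral_mult_right)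
       (simp_all add: has_bochner_integral_iff first second)
  then have int: "integrable (gaussian_PiM d \<sigma>) Y"
    and "expectation Y = (\<Sum>i<d. c i * 0) - (\<Sum>i<d. \<Sum>j<d. A $$ (i, j) / 2 * (if i = j then \<sigma>\<^sup>2 else 0))"
    by (simp_all only: has_bochner_integral_iff)
  note this(2)
  also have "\<dots> = - \<sigma>\<^sup>2 * (\<Sum>i<d. A $$ (i, i)) / 2"
    by (simp add: mult_delta_right sum_distrib_left sum_divide_distrib sum_negf[symmetric] mult.commute)
  finally have EY: "expectation Y = - \<sigma>\<^sup>2 * (\<Sum>i<d. A $$ (i, i)) / 2" .
  show ?thesis
    unfolding Y EY[symmetric]
  proof (cases "(\<integral>\<^sup>+ u. ennreal (exp (Y u)) \<partial>gaussian_PiM d \<sigma>) = \<infinity>")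
    case False
    have [measurable]: "Y \<in> borel_measurable (gaussian_PiM d \<sigma>)" using int by simp
    have int': "integrable (gaussian_PiM d \<sigma>) (\<lambda>u. exp (Y u))"
      using False by (intro integrableI_nonneg) (auto simp: less_top)
    \<comment> \<open>The tangent of exp at the mean lies below exp, and its deviation term
      integrates to zero.\<close>
    have "exp (expectation Y) = expectation (\<lambda>u. exp (expectation Y) * (1 + (Y u - expectation Y)))"
      using int by (simp add: prob_space)
    also have "\<dots> \<le> expectation (\<lambda>u. exp (Y u))"
    proof (rule integral_mono)
      fix u
      have "exp (expectation Y) * (1 + (Y u - expectation Y)) \<le> exp (expectation Y) * exp (Y u - expectation Y)"
        by (intro mult_left_mono exp_ge_add_one_self) simp
      then show "exp (expectation Y) * (1 + (Y u - expectation Y)) \<le> exp (Y u)"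
        by (simp add: exp_add[symmetric])
    qed (use int int' in auto)
    finally show "ennreal (exp (expectation Y)) \<le> (\<integral>\<^sup>+ u. ennreal (exp (Y u)) \<partial>gaussian_PiM d \<sigma>)"
      using int' by (simp add: nn_integral_eq_integral ennreal_leI)
  qed simp
qed

section \<open>From exponential moments to the tail of the squared norm\<close>

lemma exp_sq_le_gaussian_mixture:
  assumes A: "sym_pos_def d A" and l: "0 < l" "\<And>x. qform d A x \<le> l * (\<Sum>i<d. (x i)\<^sup>2)"
  shows "ennreal (exp ((\<Sum>i<d. (z i)\<^sup>2) / (4 * l))) * ennreal (exp (- (\<Sum>i<d. A $$ (i, i)) / (2 * l)))
    \<le> (\<integral>\<^sup>+ u. ennreal (exp ((\<Sum>i<d. u i * z i) - qform d A u / 2)) \<partial>gaussian_PiM d (1 / sqrt l))"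
proof -
  note [measurable] = measurable_component_lborel[of _ "{..<d}"]
  have [measurable]: "(\<lambda>u. qform d A u) \<in> borel_measurable (lborel_PiM d)"
    by (intro measurable_qform) measurable
  define \<sigma> where "\<sigma> = 1 / sqrt l"
  have \<sigma>: "0 < \<sigma>" "\<sigma>\<^sup>2 = 1 / l" using l(1) by (auto simp: \<sigma>_def power_divide)
  \<comment> \<open>Bounding the form by l |a|^2, the constant gained by recentring at a is at least
    a . z - l |a|^2. This choice maximises that expression, with value |z|^2 / (4 l).\<close>
  define a where "a i = z i / (2 * l)" for i
  define c where "c i = z i - mat_apply d A a i - l * a i" for i
  define b where "b = (\<Sum>i<d. a i * z i) - qform d A a / 2 - l * (\<Sum>i<d. (a i)\<^sup>2) / 2"
  have "qform d A a / 2 + l * (\<Sum>i<d. (a i)\<^sup>2) / 2 \<le> l * (\<Sum>i<d. (a i)\<^sup>2)"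
    using l(2)[of a] by simp
  also have "\<dots> = (\<Sum>i<d. (z i)\<^sup>2) / (4 * l)"
    using l(1) by (simp add: a_def power_divide sum_divide_distrib[symmetric] power2_eq_square)
  finally have "(\<Sum>i<d. (z i)\<^sup>2) / (2 * l) - (\<Sum>i<d. (z i)\<^sup>2) / (4 * l) \<le> b"
    by (simp add: b_def a_def power2_eq_square sum_divide_distrib)
  then have b: "(\<Sum>i<d. (z i)\<^sup>2) / (4 * l) \<le> b" by simp
  \<comment> \<open>Recentring splits off the constant \<open>b\<close>; all cross terms are
    collected in the linear coefficient \<open>c\<close>, which Jensen's inequality averages
    out.\<close>
  have expo: "(\<Sum>i<d. translate d a u i * z i) - qform d A (translate d a u) / 2
      + - (\<Sum>i<d. 2 * u i * a i + (a i)\<^sup>2) / (2 * \<sigma>\<^sup>2) = b + ((\<Sum>i<d. c i * u i) - qform d A u / 2)" for u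
  proof -
    have "qform d A (translate d a u) = qform d A (\<lambda>i. u i + a i)" by (rule qform_cong) simp
    moreover have "(\<Sum>i<d. translate d a u i * z i) = (\<Sum>i<d. u i * z i) + (\<Sum>i<d. a i * z i)"
      by (simp add: distrib_right sum.distrib)
    moreover have "(\<Sum>i<d. 2 * u i * a i + (a i)\<^sup>2) = 2 * (\<Sum>i<d. u i * a i) + (\<Sum>i<d. (a i)\<^sup>2)"
      by (simp add: sum.distrib sum_distrib_left mult.assoc)
    then have "(\<Sum>i<d. 2 * u i * a i + (a i)\<^sup>2) / (2 * \<sigma>\<^sup>2) = l * (\<Sum>i<d. u i * a i) + l * (\<Sum>i<d. (a i)\<^sup>2) / 2"
      using l(1) by (simp add: \<sigma> field_simps)
    moreover have "(\<Sum>i<d. c i * u i) = (\<Sum>i<d. u i * z i) - (\<Sum>i<d. u i * mat_apply d A a i) - l * (\<Sum>i<d. u i * a i)"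
      by (simp add: c_def sum_subtractf sum.distrib sum_distrib_left algebra_simps)
    ultimately show ?thesis by (simp add: qform_add[OF A] b_def add_divide_distrib)
  qed
  have "ennreal (exp ((\<Sum>i<d. (z i)\<^sup>2) / (4 * l))) * ennreal (exp (- (\<Sum>i<d. A $$ (i, i)) / (2 * l)))
      \<le> ennreal (exp b) * ennreal (exp (- \<sigma>\<^sup>2 * (\<Sum>i<d. A $$ (i, i)) / 2))"
    using b by (intro mult_mono ennreal_leI) (simp_all add: \<sigma>)
  also have "\<dots> \<le> ennreal (exp b) * (\<integral>\<^sup>+ u. ennreal (exp ((\<Sum>i<d. c i * u i) - qform d A u / 2)) \<partial>gaussian_PiM d \<sigma>)"
    using \<sigma>(1) by (intro mult_left_mono gaussian_PiM_jensen) auto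
  also have "\<dots> = (\<integral>\<^sup>+ u. ennreal (exp b) * ennreal (exp ((\<Sum>i<d. c i * u i) - qform d A u / 2)) \<partial>gaussian_PiM d \<sigma>)"
    by (rule nn_integral_cmult[symmetric]) measurable
  also have "\<dots> = (\<integral>\<^sup>+ u. ennreal (exp ((\<Sum>i<d. translate d a u i * z i) - qform d A (translate d a u) / 2))
      * ennreal (exp (- (\<Sum>i<d. 2 * u i * a i + (a i)\<^sup>2) / (2 * \<sigma>\<^sup>2))) \<partial>gaussian_PiM d \<sigma>)"
    by (intro nn_integral_cong) (simp only: ennreal_mult[symmetric] exp_ge_zero exp_add[symmetric] expo)
  also have "\<dots> = (\<integral>\<^sup>+ u. ennreal (exp ((\<Sum>i<d. u i * z i) - qform d A u / 2)) \<partial>gaussian_PiM d \<sigma>)"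
    by (rule nn_integral_gaussian_PiM_translate[OF \<sigma>(1), symmetric]) measurable
  finally show ?thesis by (simp add: \<sigma>_def)
qed

text \<open>By Fubini, mixing the moment generating function bound over u gives an exponential
  moment of the squared norm at most exp (tr A / (2 l)); Markov's inequality finishes.\<close>

theorem (in prob_space) subgaussian_sq_norm_tail:
  assumes A: "sym_pos_def d A" and l: "0 < l" "\<And>x. qform d A x \<le> l * (\<Sum>i<d. (x i)\<^sup>2)"
    and Z[measurable]: "\<And>i. i < d \<Longrightarrow> (\<lambda>\<omega>. Z \<omega> i) \<in> borel_measurable M"
    and mgf: "\<And>u. (\<integral>\<^sup>+ \<omega>. ennreal (exp (\<Sum>i<d. u i * Z \<omega> i)) \<partial>M) \<le> ennreal (exp (qform d A u / 2))"
    and "0 < \<delta>"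
  shows "1 - \<delta> \<le> prob {\<omega> \<in> space M. (\<Sum>i<d. (Z \<omega> i)\<^sup>2) \<le> 2 * (\<Sum>i<d. A $$ (i, i)) + 4 * l * ln (1 / \<delta>)}"
proof -
  let ?G = "gaussian_PiM d (1 / sqrt l)"
  let ?tr = "\<Sum>i<d. A $$ (i, i)"
  \<comment> \<open>\<open>K\<close> solves K / (4 l) - tr A / (2 l) = ln (1 / \<delta>), so beyond
    \<open>K\<close> the integrand of mean at most 1 exceeds 1 / \<delta>.\<close>
  define K where "K = 2 * ?tr + 4 * l * ln (1 / \<delta>)"
  have G: "prob_space ?G" using l by (intro prob_space_gaussian_PiM) simp
  interpret G: prob_space ?G by (rule G)
  interpret P: pair_sigma_finite M ?G
    by (intro pair_sigma_finite.intro prob_space_imp_sigma_finite G prob_space_axioms)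
  have comp: "(\<lambda>u. u i) \<in> borel_measurable ?G" if "i < d" for i
    using measurable_component_lborel[of i "{..<d}"] that by (simp cong: measurable_cong_sets)
  have [measurable]: "(\<lambda>p. snd p i) \<in> borel_measurable (M \<Otimes>\<^sub>M ?G)" if "i < d" for i
    using that by (intro measurable_compose[OF measurable_snd comp])
  have [measurable]: "(\<lambda>u. qform d A u) \<in> borel_measurable ?G"
    by (intro measurable_qform comp)
  have "(\<integral>\<^sup>+ \<omega>. ennreal (exp ((\<Sum>i<d. (Z \<omega> i)\<^sup>2) / (4 * l))) * ennreal (exp (- ?tr / (2 * l))) \<partial>M)
      \<le> (\<integral>\<^sup>+ \<omega>. \<integral>\<^sup>+ u. ennreal (exp ((\<Sum>i<d. u i * Z \<omega> i) - qform d A u / 2)) \<partial>?G \<partial>M)"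
    by (intro nn_integral_mono exp_sq_le_gaussian_mixture[OF A l])
  also have "\<dots> = (\<integral>\<^sup>+ u. \<integral>\<^sup>+ \<omega>. ennreal (exp ((\<Sum>i<d. u i * Z \<omega> i) - qform d A u / 2)) \<partial>M \<partial>?G)"
    by (rule P.Fubini'[symmetric]) measurable
  also have "\<dots> \<le> (\<integral>\<^sup>+ u. 1 \<partial>?G)"
  proof (rule nn_integral_mono)
    fix u
    have "(\<integral>\<^sup>+ \<omega>. ennreal (exp ((\<Sum>i<d. u i * Z \<omega> i) - qform d A u / 2)) \<partial>M)
        = (\<integral>\<^sup>+ \<omega>. ennreal (exp (- qform d A u / 2)) * ennreal (exp (\<Sum>i<d. u i * Z \<omega> i)) \<partial>M)"
      by (intro nn_integral_cong) (simp add: ennreal_mult[symmetric] exp_add[symmetric])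
    also have "\<dots> = ennreal (exp (- qform d A u / 2)) * (\<integral>\<^sup>+ \<omega>. ennreal (exp (\<Sum>i<d. u i * Z \<omega> i)) \<partial>M)"
      by (rule nn_integral_cmult) measurable
    also have "\<dots> \<le> ennreal (exp (- qform d A u / 2)) * ennreal (exp (qform d A u / 2))"
      by (intro mult_left_mono mgf) simp
    also have "\<dots> = 1" by (simp add: ennreal_mult[symmetric] exp_add[symmetric])
    finally show "(\<integral>\<^sup>+ \<omega>. ennreal (exp ((\<Sum>i<d. u i * Z \<omega> i) - qform d A u / 2)) \<partial>M) \<le> 1" .
  qed
  also have "\<dots> = 1" by (simp add: G.emeasure_space_1)
  finally have mean: "(\<integral>\<^sup>+ \<omega>. ennreal (exp ((\<Sum>i<d. (Z \<omega> i)\<^sup>2) / (4 * l))) * ennreal (exp (- ?tr / (2 * l))) \<partial>M) \<le> 1" .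
  define B where "B = {\<omega> \<in> space M. K < (\<Sum>i<d. (Z \<omega> i)\<^sup>2)}"
  have B[measurable]: "B \<in> events" unfolding B_def by measurable
  have "ennreal (1 / \<delta>) * emeasure M B = (\<integral>\<^sup>+ \<omega>. ennreal (1 / \<delta>) * indicator B \<omega> \<partial>M)"
    using B by (simp add: nn_integral_cmult_indicator)
  also have "\<dots> \<le> (\<integral>\<^sup>+ \<omega>. ennreal (exp ((\<Sum>i<d. (Z \<omega> i)\<^sup>2) / (4 * l))) * ennreal (exp (- ?tr / (2 * l))) \<partial>M)"
  proof (rule nn_integral_mono)
    fix \<omega>
    show "ennreal (1 / \<delta>) * indicator B \<omega>
        \<le> ennreal (exp ((\<Sum>i<d. (Z \<omega> i)\<^sup>2) / (4 * l))) * ennreal (exp (- ?tr / (2 * l)))"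
    proof (cases "\<omega> \<in> B")
      case True
      have "1 / \<delta> = exp (K / (4 * l) + - ?tr / (2 * l))"
        using l(1) \<open>0 < \<delta>\<close> by (simp add: K_def add_divide_distrib exp_ln)
      also have "\<dots> \<le> exp ((\<Sum>i<d. (Z \<omega> i)\<^sup>2) / (4 * l) + - ?tr / (2 * l))"
        using True l(1) by (simp add: B_def divide_right_mono)
      finally show ?thesis
        using True by (simp add: ennreal_mult[symmetric] exp_add[symmetric] ennreal_leI)
    qed simp
  qed
  also note mean
  finally have "ennreal (1 / \<delta>) * ennreal (prob B) \<le> 1"
    by (simp only: emeasure_eq_measure)
  then have "ennreal (1 / \<delta> * prob B) \<le> ennreal 1"
    using \<open>0 < \<delta>\<close> by (subst ennreal_mult) simp_all
  then have "1 / \<delta> * prob B \<le> 1" by (simp only: ennreal_le_iff zero_le_one)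
  then have "prob B \<le> \<delta>" using \<open>0 < \<delta>\<close> by (simp add: field_simps)
  moreover have "{\<omega> \<in> space M. (\<Sum>i<d. (Z \<omega> i)\<^sup>2) \<le> K} = space M - B"
    by (auto simp: B_def)
  ultimately show ?thesis
    unfolding K_def[symmetric] using prob_compl[OF B] by simp
qed

section \<open>Coverage of the sample mean\<close>

lemma sym_pos_def_smult:
  assumes "sym_pos_def d A" "0 < c"
  shows "sym_pos_def d (c \<cdot>\<^sub>m A)" "qform d (c \<cdot>\<^sub>m A) x = c * qform d A x"
proof -
  note A = sym_pos_def_carrier[OF assms(1)]
  have q: "qform d (c \<cdot>\<^sub>m A) x = c * qform d A x" for x
    unfolding qform_def sum_distrib_left using A by (intro sum.cong refl) auto
  show "sym_pos_def d (c \<cdot>\<^sub>m A)"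
  proof (rule sym_pos_defI)
    show "(c \<cdot>\<^sub>m A) $$ (i, j) = (c \<cdot>\<^sub>m A) $$ (j, i)" if "i < d" "j < d" for i j
      using that A sym_pos_def_sym[OF assms(1) that] by simp
  qed (use A assms q in \<open>auto intro!: mult_pos_pos sym_pos_def_qform_pos\<close>)
  show "qform d (c \<cdot>\<^sub>m A) x = c * qform d A x" by (rule q)
qed

context gaussian_location
begin

definition sample_mean :: "(nat \<Rightarrow> nat \<Rightarrow> real) \<Rightarrow> nat \<Rightarrow> real" where
  "sample_mean x = (\<lambda>i\<in>{..<d}. (\<Sum>j<n. x j i) / n)"

lemma measurable_sample_mean [measurable]: "sample_mean \<in> measurable sample_space (lborel_PiM d)"
  unfolding sample_mean_def
  by (rule measurable_restrict)
     (auto intro!: borel_measurable_divide borel_measurable_sum measurable_sample_component)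

text \<open>Independence gives n equal factors at u / n, and n times the form at u / n is the form
  at u divided by n.\<close>

lemma nn_integral_exp_sample_mean:
  assumes "1 \<le> n"
  shows "(\<integral>\<^sup>+ x. ennreal (exp (\<Sum>i<d. u i * (sample_mean x i - \<theta> i))) \<partial>sample_law \<theta>)
    = ennreal (exp (qform d \<Sigma> u / n / 2))"
proof -
  interpret product_sigma_finite "\<lambda>_::nat. mvn d \<theta> \<Sigma>"
    by (simp add: product_sigma_finite_def prob_space_imp_sigma_finite prob_space_mvn[OF spd])
  note [measurable] = measurable_component_lborel[of _ "{..<d}"]
  let ?v = "\<lambda>i. 1 / real n * u i"
  have "(\<Sum>i<d. u i * (sample_mean x i - \<theta> i)) = (\<Sum>j<n. \<Sum>i<d. ?v i * (x j i - \<theta> i))" for x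
  proof -
    have "(\<Sum>i<d. u i * (sample_mean x i - \<theta> i)) = (\<Sum>i<d. \<Sum>j<n. ?v i * (x j i - \<theta> i))"
    proof (intro sum.cong refl)
      fix i assume "i \<in> {..<d}"
      then have "u i * (sample_mean x i - \<theta> i) = ?v i * ((\<Sum>j<n. x j i) - n * \<theta> i)"
        using assms by (simp add: sample_mean_def field_simps)
      also have "(\<Sum>j<n. x j i) - n * \<theta> i = (\<Sum>j<n. x j i - \<theta> i)"
        by (simp add: sum_subtractf)
      finally show "u i * (sample_mean x i - \<theta> i) = (\<Sum>j<n. ?v i * (x j i - \<theta> i))"
        by (simp add: sum_distrib_left)
    qed
    then show ?thesis by (simp only: sum.swap[of _ "{..<n}"])
  qed
  then have "ennreal (exp (\<Sum>i<d. u i * (sample_mean x i - \<theta> i)))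
      = (\<Prod>j<n. ennreal (exp (\<Sum>i<d. ?v i * (x j i - \<theta> i))))" for x
    by (simp add: exp_sum[of "{..<n}"] prod_ennreal)
  then have "(\<integral>\<^sup>+ x. ennreal (exp (\<Sum>i<d. u i * (sample_mean x i - \<theta> i))) \<partial>sample_law \<theta>)
      = (\<integral>\<^sup>+ x. (\<Prod>j<n. ennreal (exp (\<Sum>i<d. ?v i * (x j i - \<theta> i)))) \<partial>PiM {..<n} (\<lambda>_. mvn d \<theta> \<Sigma>))"
    by (simp only: iid_sample_def)
  also have "\<dots> = (\<Prod>j<n. \<integral>\<^sup>+ y. ennreal (exp (\<Sum>i<d. ?v i * (y i - \<theta> i))) \<partial>mvn d \<theta> \<Sigma>)"
    by (rule product_nn_integral_prod) (simp, measurable)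
  also have "\<dots> = ennreal (exp (qform d \<Sigma> ?v / 2)) ^ n"
    unfolding nn_integral_exp_mvn[OF spd] by simp
  also have "\<dots> = ennreal (exp (n * (qform d \<Sigma> ?v / 2)))"
    by (simp only: ennreal_power exp_ge_zero exp_of_nat_mult)
  also have "n * (qform d \<Sigma> ?v / 2) = qform d \<Sigma> u / n / 2"
    unfolding qform_scale using assms by (simp add: power_divide power2_eq_square)
  finally show ?thesis .
qed

lemma sample_mean_confidence:
  assumes "1 \<le> n" "1 \<le> d" "0 < \<delta>"
  shows "1 - \<delta> \<le> measure (sample_law \<theta>)
    {x \<in> space sample_space. sq_loss d (sample_mean x) \<theta> \<le> 2 * (mat_trace \<Sigma> / n) + 4 * (op_norm \<Sigma> / n) * ln (1 / \<delta>)}"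
proof -
  interpret P: prob_space "sample_law \<theta>" by (rule prob_space_sample_law)
  let ?A = "(1 / real n) \<cdot>\<^sub>m \<Sigma>"
  have n: "0 < 1 / real n" using assms by simp
  note \<Sigma> = sym_pos_def_carrier[OF spd]
  have "(\<Sum>i<d. ?A $$ (i, i)) = mat_trace \<Sigma> / n"
    unfolding mat_trace_eq[OF \<Sigma>] sum_divide_distrib using \<Sigma> by (intro sum.cong refl) auto
  moreover have "1 - \<delta> \<le> measure (sample_law \<theta>) {x \<in> space (sample_law \<theta>).
      (\<Sum>i<d. (sample_mean x i - \<theta> i)\<^sup>2) \<le> 2 * (\<Sum>i<d. ?A $$ (i, i)) + 4 * (op_norm \<Sigma> / n) * ln (1 / \<delta>)}"
  proof (rule P.subgaussian_sq_norm_tail[OF sym_pos_def_smult(1)[OF spd n]])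
    show "0 < op_norm \<Sigma> / n" using op_norm_pos[OF spd assms(2)] assms by simp
    show "qform d ?A x \<le> op_norm \<Sigma> / n * (\<Sum>i<d. (x i)\<^sup>2)" for x
      using qform_le_op_norm[OF \<Sigma>, of x] assms
      by (simp add: sym_pos_def_smult(2)[OF spd n] L2_set_def sum_nonneg divide_right_mono)
    show "(\<lambda>x. sample_mean x i - \<theta> i) \<in> borel_measurable (sample_law \<theta>)" if "i < d" for i
      using measurable_compose[OF measurable_sample_mean measurable_component_lborel[of i "{..<d}"]] that
      by (simp cong: measurable_cong_sets)
    show "(\<integral>\<^sup>+ x. ennreal (exp (\<Sum>i<d. u i * (sample_mean x i - \<theta> i))) \<partial>sample_law \<theta>)
        \<le> ennreal (exp (qform d ?A u / 2))" for u
      by (simp add: nn_integral_exp_sample_mean[OF assms(1)] sym_pos_def_smult(2)[OF spd n])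
  qed fact
  ultimately show ?thesis by (simp add: sq_loss_eq)
qed

end

subsection \<open>The minimax quantile\<close>

lemma upper_quantile_le:
  assumes "0 \<le> r" "1 - \<delta> \<le> measure P {x \<in> space P. f x \<le> r}"
  shows "upper_quantile \<delta> P f \<le> ennreal r"
  unfolding upper_quantile_def using assms by (intro Inf_lower) auto

text \<open>The strict inequality supplies an admissible radius below \<open>r\<close>, so the
  infimum may be used without being attained; monotonicity does the rest.\<close>

lemma upper_quantile_less:
  assumes "finite_measure P" "f \<in> borel_measurable P" "upper_quantile \<delta> P f < ennreal r"
  shows "1 - \<delta> \<le> measure P {x \<in> space P. f x \<le> r}"
proof -
  interpret finite_measure P by fact
  note [measurable] = assms(2)
  from assms(3) obtain s where s: "0 \<le> s" "1 - \<delta> \<le> measure P {x \<in> space P. f x \<le> s}" "ennreal s < ennreal r"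
    unfolding upper_quantile_def Inf_less_iff by auto
  note s(2)
  also have "measure P {x \<in> space P. f x \<le> s} \<le> measure P {x \<in> space P. f x \<le> r}"
    using s(1,3) by (intro finite_measure_mono) (auto simp: ennreal_less_iff)
  finally show ?thesis .
qed

lemma sets_euclidean_borel: "sets (euclidean_borel d) = sets (lborel_PiM d)"
  unfolding euclidean_borel_def by (intro sets_PiM_cong) auto

lemma space_euclidean_borel: "space (euclidean_borel d) = space (lborel_PiM d)"
  using sets_euclidean_borel by (rule sets_eq_imp_space_eq)

text \<open>The minimax quantile is stated with \<open>borel\<close> factors and the laws with
  \<open>lborel\<close> factors; estimators only see the common \<sigma>-algebra.\<close>

lemma measurable_euclidean_estimator:
  "measurable (iid_sample n (euclidean_borel d)) (euclidean_borel d)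
    = measurable (PiM {..<n} (\<lambda>_. lborel_PiM d)) (lborel_PiM d)"
  unfolding iid_sample_def
  by (intro measurable_cong_sets sets_PiM_cong sets_euclidean_borel refl)

section \<open>The two sides of the rate\<close>

context gaussian_location
begin

abbreviation "minimax_risk \<delta> \<equiv>
  minimax_quantile (iid_sample n (euclidean_borel d)) (euclidean_borel d) \<delta>
    (\<lambda>\<theta>. {sample_law \<theta>}) (sq_loss d)"

definition "rate \<delta> = mat_trace \<Sigma> / n + op_norm \<Sigma> * ln (1 / \<delta>) / n"

lemma rate_pos:
  assumes "1 \<le> n" "1 \<le> d" "0 < \<delta>" "\<delta> \<le> 1 / 4"
  shows "0 < mat_trace \<Sigma> / n" "0 \<le> op_norm \<Sigma> * ln (1 / \<delta>) / n"
  using mat_trace_pos[OF spd assms(2)] op_norm_pos[OF spd assms(2)] assms by auto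

lemma minimax_risk_le:
  assumes "1 \<le> n" "1 \<le> d" "0 < \<delta>" "\<delta> \<le> 1 / 4"
  shows "minimax_risk \<delta> \<le> ennreal (4 * rate \<delta>)"
proof -
  let ?K = "2 * (mat_trace \<Sigma> / n) + 4 * (op_norm \<Sigma> / n) * ln (1 / \<delta>)"
  have K: "0 \<le> ?K" "?K \<le> 4 * rate \<delta>" using rate_pos[OF assms] by (auto simp: rate_def)
  have "minimax_risk \<delta> \<le> (SUP \<theta>\<in>space (euclidean_borel d). SUP P\<in>{sample_law \<theta>}.
      upper_quantile \<delta> P (\<lambda>x. sq_loss d (sample_mean x) \<theta>))"
    unfolding minimax_quantile_def
    by (rule INF_lower) (simp add: measurable_euclidean_estimator)
  also have "\<dots> \<le> ennreal ?K"
  proof (intro SUP_least)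
    fix \<theta> P assume "P \<in> {sample_law \<theta>}"
    then have P: "P = sample_law \<theta>" by simp
    show "upper_quantile \<delta> P (\<lambda>x. sq_loss d (sample_mean x) \<theta>) \<le> ennreal ?K"
      unfolding P using sample_mean_confidence[OF assms(1-3), of \<theta>]
      by (intro upper_quantile_le K(1)) (simp only: space_sample_law)
  qed
  also have "\<dots> \<le> ennreal (4 * rate \<delta>)" using K(2) by (rule ennreal_leI)
  finally show ?thesis .
qed

text \<open>An estimator of smaller risk would have coverage 1 - \<delta> at the single radius
  \<open>rate \<delta> / 400\<close> for every parameter, contradicting the two radius bounds taken
  together.\<close>

lemma minimax_risk_ge:
  assumes "1 \<le> n" "1 \<le> d" "0 < \<delta>" "\<delta> \<le> 1 / 4"
  shows "ennreal (rate \<delta> / 400) \<le> minimax_risk \<delta>"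
  unfolding minimax_quantile_def
proof (rule INF_greatest, rule ccontr)
  fix T assume "T \<in> measurable (iid_sample n (euclidean_borel d)) (euclidean_borel d)"
  then have T[measurable]: "T \<in> measurable sample_space (lborel_PiM d)"
    by (simp add: measurable_euclidean_estimator)
  assume "\<not> ennreal (rate \<delta> / 400) \<le> (SUP \<theta>\<in>space (euclidean_borel d). SUP P\<in>{sample_law \<theta>}.
      upper_quantile \<delta> P (\<lambda>x. sq_loss d (T x) \<theta>))"
  then have sup: "(SUP \<theta>\<in>space (lborel_PiM d). upper_quantile \<delta> (sample_law \<theta>) (\<lambda>x. sq_loss d (T x) \<theta>))
      < ennreal (rate \<delta> / 400)"
    by (simp only: not_le space_euclidean_borel image_insert image_empty ccpo_Sup_singleton)
  have less: "upper_quantile \<delta> (sample_law \<theta>) (\<lambda>x. sq_loss d (T x) \<theta>) < ennreal (rate \<delta> / 400)"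
    if "\<theta> \<in> space (lborel_PiM d)" for \<theta>
    using SUP_upper[OF that] sup by (rule le_less_trans)
  have "1 - \<delta> \<le> measure (sample_law \<theta>) {x \<in> space sample_space. sq_loss d (T x) \<theta> \<le> rate \<delta> / 400}"
    if \<theta>: "\<theta> \<in> space (lborel_PiM d)" for \<theta>
  proof -
    interpret P: prob_space "sample_law \<theta>" by (rule prob_space_sample_law)
    have "(\<lambda>x. T x i) \<in> borel_measurable (sample_law \<theta>)" if "i < d" for i
      using measurable_compose[OF T measurable_component_lborel[of i "{..<d}"]] that
      by (simp cong: measurable_cong_sets)
    then have "(\<lambda>x. sq_loss d (T x) \<theta>) \<in> borel_measurable (sample_law \<theta>)"
      unfolding sq_loss_eq by measurable
    from upper_quantile_less[OF P.finite_measure_axioms this less[OF \<theta>]] show ?thesis by simp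
  qed
  note conf = this
  \<comment> \<open>The trace term would be at most 9 / 10 of the rate and the operator norm term at
    most 1 / 40, so the positive rate would be at most 37 / 40 of itself.\<close>
  have "mat_trace \<Sigma> / (360 * n) \<le> rate \<delta> / 400"
    using conf by (intro confidence_radius_ge_trace[OF T]) (use assms in auto)
  moreover have "op_norm \<Sigma> * ln (1 / \<delta>) / (10 * n) \<le> rate \<delta> / 400"
    using conf by (intro confidence_radius_ge_op_norm[OF T]) (use assms in auto)
  ultimately have "mat_trace \<Sigma> / n / 360 \<le> rate \<delta> / 400" "op_norm \<Sigma> * ln (1 / \<delta>) / n / 10 \<le> rate \<delta> / 400"
    by (simp_all add: mult.commute)
  then show False using rate_pos[OF assms] by (simp add: rate_def)
qed

end

theorem proposition10:
  shows "\<exists>c>0. \<exists>C>0. \<forall>(n::nat) (d::nat) (\<delta>::real) (\<Sigma>::real mat).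
     1 \<le> n \<and> 1 \<le> d \<and> 0 < \<delta> \<and> \<delta> \<le> 1 / 4 \<and> sym_pos_def d \<Sigma> \<longrightarrow>
     (let rate = mat_trace \<Sigma> / real n + op_norm \<Sigma> * ln (1 / \<delta>) / real n;
          M = minimax_quantile (iid_sample n (euclidean_borel d)) (euclidean_borel d) \<delta>
                (\<lambda>\<theta>. {iid_sample n (mvn d \<theta> \<Sigma>)}) (sq_loss d)
      in ennreal (c * rate) \<le> M \<and> M \<le> ennreal (C * rate))"
proof (intro exI conjI allI impI)
  fix n d :: nat and \<delta> :: real and \<Sigma> :: "real mat"
  assume *: "1 \<le> n \<and> 1 \<le> d \<and> 0 < \<delta> \<and> \<delta> \<le> 1 / 4 \<and> sym_pos_def d \<Sigma>"
  interpret gaussian_location d n \<Sigma> by standard (use * in simp)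
  show "let rate = mat_trace \<Sigma> / real n + op_norm \<Sigma> * ln (1 / \<delta>) / real n;
          M = minimax_risk \<delta>
      in ennreal (1 / 400 * rate) \<le> M \<and> M \<le> ennreal (4 * rate)"
    using minimax_risk_le[of \<delta>] minimax_risk_ge[of \<delta>] * by (simp add: rate_def Let_def)
qed simp_all

end
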